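(* Let $s<-2$. If there exists some $T>0$ such that the initial value problem $$u_{tt}-u_{xx}+u_{xxxx}+(u^2)_{xx}=0,\quad x\in\mathbb{R},\ t>0,\qquad u(0,x)=\phi(x),\quad u_t(0,x)=\psi_x(x),$$ is locally well-posed, then the flow-map data solution $$S:H^s(\mathbb{R})\times H^{s-1}(\mathbb{R})\to C([0,T]:H^s(\mathbb{R})),\qquad (\phi,\psi)\mapsto u(t),$$ is not $C^2$ at zero.
   Context: $\langle a\rangle=1+|a|$; $H^s(\mathbb{R})$ is the Sobolev space with norm $\|f\|_{H^s}=\|\langle\xi\rangle^s\widehat f\|_{L^2}$. With $\gamma(\xi)=\sqrt{\xi^2+\xi^4}$, define via the spatial Fourier transform $$\widehat{V_c(t)\phi}(\xi)=\frac{e^{it\gamma(\xi)}+e^{-it\gamma(\xi)}}{2}\,\widehat\phi(\xi),\qquad \widehat{V_s(t)g}(\xi)=\frac{e^{it\gamma(\xi)}-e^{-it\gamma(\xi)}}{2i\gamma(\xi)}\,\widehat g(\xi).$$ In the definition of $S$, $u(t)$ is the solution of the initial value problem with data $(\phi,\psi)$, given by the equivalent integral equation $$u(t)=V_c(t)\phi+V_s(t)\psi_x-\int_0^tV_s(t-t')(u^2)_{xx}(t')\,dt'.$$ *)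

theory Defs
  imports "HOL-Analysis.Analysis"
begin

section \<open>The Hilbert space of square integrable functions on the line\<close>

definition square_integrable :: "(real \<Rightarrow> complex) \<Rightarrow> bool" where
  "square_integrable f \<longleftrightarrow>
     f \<in> borel_measurable borel \<and> integrable lborel (\<lambda>x. (cmod (f x))\<^sup>2)"

definition L2_rel :: "(real \<Rightarrow> complex) \<Rightarrow> (real \<Rightarrow> complex) \<Rightarrow> bool" where
  "L2_rel f g \<longleftrightarrow> square_integrable f \<and> square_integrable g \<and> (AE x in lborel. f x = g x)"

lemma square_integrable_zero: "square_integrable (\<lambda>_. 0)"
  by (simp add: square_integrable_def)

quotient_type L2 = "real \<Rightarrow> complex" / partial: L2_rel
proof (rule part_equivpI)
  show "\<exists>f. L2_rel f f"
    using square_integrable_zero by (auto simp: L2_rel_def)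
  show "symp L2_rel"
    by (rule sympI) (auto simp: L2_rel_def elim: eventually_mono)
  show "transp L2_rel"
    by (rule transpI) (auto simp: L2_rel_def elim: eventually_elim2)
qed

lemma square_integrable_add:
  assumes "square_integrable f" "square_integrable g"
  shows "square_integrable (\<lambda>x. f x + g x)"
proof -
  have [measurable]: "f \<in> borel_measurable borel" "g \<in> borel_measurable borel"
    using assms by (auto simp: square_integrable_def)
  have "integrable lborel (\<lambda>x. 2 * (cmod (f x))\<^sup>2 + 2 * (cmod (g x))\<^sup>2)"
    using assms by (auto simp: square_integrable_def)
  moreover have "(cmod (f x + g x))\<^sup>2 \<le> 2 * (cmod (f x))\<^sup>2 + 2 * (cmod (g x))\<^sup>2" for x
  proof -
    have "(cmod (f x + g x))\<^sup>2 \<le> (cmod (f x) + cmod (g x))\<^sup>2"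
      by (intro power_mono norm_triangle_ineq norm_ge_zero)
    moreover have "0 \<le> (cmod (f x) - cmod (g x))\<^sup>2"
      by simp
    ultimately show ?thesis
      by (simp add: power2_sum power2_diff)
  qed
  ultimately have "integrable lborel (\<lambda>x. (cmod (f x + g x))\<^sup>2)"
    by (elim Bochner_Integration.integrable_bound) auto
  then show ?thesis
    by (simp add: square_integrable_def)
qed

lemma square_integrable_scaleR:
  assumes "square_integrable f"
  shows "square_integrable (\<lambda>x. c *\<^sub>R f x)"
proof -
  have [measurable]: "f \<in> borel_measurable borel"
    using assms by (auto simp: square_integrable_def)
  have "integrable lborel (\<lambda>x. c\<^sup>2 * (cmod (f x))\<^sup>2)"
    using assms by (auto simp: square_integrable_def)
  then show ?thesis
    by (simp add: square_integrable_def power_mult_distrib)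
qed

lemma square_integrable_inner:
  assumes "square_integrable f" "square_integrable g"
  shows "integrable lborel (\<lambda>x. inner (f x) (g x))"
proof -
  have [measurable]: "f \<in> borel_measurable borel" "g \<in> borel_measurable borel"
    using assms by (auto simp: square_integrable_def)
  have "integrable lborel (\<lambda>x. (cmod (f x))\<^sup>2 + (cmod (g x))\<^sup>2)"
    using assms by (auto simp: square_integrable_def)
  moreover have "\<bar>inner (f x) (g x)\<bar> \<le> (cmod (f x))\<^sup>2 + (cmod (g x))\<^sup>2" for x
  proof -
    have "\<bar>inner (f x) (g x)\<bar> \<le> cmod (f x) * cmod (g x)"
      by (rule Cauchy_Schwarz_ineq2)
    moreover have "0 \<le> (cmod (f x) - cmod (g x))\<^sup>2" "0 \<le> cmod (f x) * cmod (g x)"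
      by simp_all
    ultimately show ?thesis
      unfolding power2_diff by linarith
  qed
  ultimately show ?thesis
    by (elim Bochner_Integration.integrable_bound) auto
qed

text \<open>Real inner product Re (f, g): the scalars of the instance are the real numbers.\<close>

instantiation L2 :: real_inner
begin

lift_definition zero_L2 :: L2 is "\<lambda>_. 0"
  using square_integrable_zero by (simp add: L2_rel_def)

lift_definition plus_L2 :: "L2 \<Rightarrow> L2 \<Rightarrow> L2" is "\<lambda>f g x. f x + g x"
  by (auto simp: L2_rel_def intro: square_integrable_add elim: eventually_elim2)

lift_definition scaleR_L2 :: "real \<Rightarrow> L2 \<Rightarrow> L2" is "\<lambda>c f x. c *\<^sub>R f x"
  by (auto simp: L2_rel_def intro: square_integrable_scaleR elim: eventually_mono)

definition uminus_L2 :: "L2 \<Rightarrow> L2" where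
  "uminus_L2 f = (-1) *\<^sub>R f"

definition minus_L2 :: "L2 \<Rightarrow> L2 \<Rightarrow> L2" where
  "minus_L2 f g = f + (-1) *\<^sub>R g"

lift_definition inner_L2 :: "L2 \<Rightarrow> L2 \<Rightarrow> real" is "\<lambda>f g. LINT x|lborel. inner (f x) (g x)"
  by (rule integral_cong_AE)
    (auto simp: L2_rel_def square_integrable_def elim: eventually_elim2)

definition norm_L2 :: "L2 \<Rightarrow> real" where
  "norm_L2 f = sqrt (inner f f)"

definition sgn_L2 :: "L2 \<Rightarrow> L2" where
  "sgn_L2 f = inverse (norm f) *\<^sub>R f"

definition dist_L2 :: "L2 \<Rightarrow> L2 \<Rightarrow> real" where
  "dist_L2 f g = norm (f - g)"

definition uniformity_L2 :: "(L2 \<times> L2) filter" where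
  "uniformity_L2 = (INF e\<in>{0<..}. principal {(x, y). dist x y < e})"

definition open_L2 :: "L2 set \<Rightarrow> bool" where
  "open_L2 U = (\<forall>x\<in>U. \<forall>\<^sub>F (x', y) in uniformity. x' = x \<longrightarrow> y \<in> U)"

instance
proof
  fix a b c :: L2 and r q :: real and U :: "L2 set"
  show "a + b + c = a + (b + c)"
    by transfer (auto simp: L2_rel_def add.assoc intro!: square_integrable_add)
  show "a + b = b + a"
    by transfer (auto simp: L2_rel_def add.commute intro!: square_integrable_add)
  show "0 + a = a"
    by transfer (auto simp: L2_rel_def)
  show "- a + a = 0"
    unfolding uminus_L2_def
    by transfer (auto simp: L2_rel_def square_integrable_zero)
  show "a - b = a + - b"
    by (simp add: uminus_L2_def minus_L2_def)
  show "r *\<^sub>R (a + b) = r *\<^sub>R a + r *\<^sub>R b"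
    by transfer (auto simp: L2_rel_def algebra_simps
        intro!: square_integrable_add square_integrable_scaleR)
  show "(r + q) *\<^sub>R a = r *\<^sub>R a + q *\<^sub>R a"
    by transfer (auto simp: L2_rel_def algebra_simps
        intro!: square_integrable_add square_integrable_scaleR)
  show "r *\<^sub>R q *\<^sub>R a = (r * q) *\<^sub>R a"
    by transfer (auto simp: L2_rel_def
        intro!: square_integrable_scaleR square_integrable_scaleR[simplified])
  show "1 *\<^sub>R a = a"
    by transfer (auto simp: L2_rel_def)
  show "dist a b = norm (a - b)"
    by (rule dist_L2_def)
  show "sgn a = inverse (norm a) *\<^sub>R a"
    by (rule sgn_L2_def)
  show "uniformity = (INF e\<in>{0<..}. principal {(x::L2, y). dist x y < e})"
    by (rule uniformity_L2_def)
  show "open U = (\<forall>x\<in>U. \<forall>\<^sub>F (x', y) in uniformity. x' = x \<longrightarrow> y \<in> U)"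
    by (rule open_L2_def)
  show "inner a b = inner b a"
    by transfer (simp add: inner_commute)
  show "inner (a + b) c = inner a c + inner b c"
    by transfer (simp add: inner_add_left L2_rel_def square_integrable_inner)
  show "inner (r *\<^sub>R a) b = r * inner a b"
    by transfer simp
  show "0 \<le> inner a a"
    by transfer simp
  show "inner a a = 0 \<longleftrightarrow> a = 0"
  proof transfer
    fix f assume "L2_rel f f"
    then have f: "square_integrable f" by (simp add: L2_rel_def)
    have "(LINT x|lborel. inner (f x) (f x)) = 0 \<longleftrightarrow> (AE x in lborel. inner (f x) (f x) = 0)"
      by (rule integral_nonneg_eq_0_iff_AE) (use f in \<open>auto intro: square_integrable_inner\<close>)
    with f show "(LINT x|lborel. inner (f x) (f x)) = 0 \<longleftrightarrow> L2_rel f (\<lambda>_. 0)"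
      by (simp add: L2_rel_def square_integrable_zero)
  qed
  show "norm a = sqrt (inner a a)"
    by (rule norm_L2_def)
qed

end


section \<open>Sobolev spaces\<close>

definition bracket :: "real \<Rightarrow> real" where
  "bracket a = 1 + \<bar>a\<bar>"

text \<open>
  An element f of \<open>H\<^sup>s(\<real>)\<close> is carried by \<open>g = \<langle>\<xi>\<rangle>\<^sup>s f\<^sup>\<and>\<close> in \<open>L\<^sup>2\<close>, so that the norm of
  \<open>H\<^sup>s(\<real>)\<close> is the norm of the type \<open>L2\<close> for every s, and \<open>sobolev_ft s g\<close> is (a representative
  of) the Fourier transform of f. The two lemmas say that this is an isometric bijection between
  \<open>L2\<close> and the a.e. classes of functions of finite \<open>H\<^sup>s\<close> norm on the Fourier side.
\<close>

definition sobolev_ft :: "real \<Rightarrow> L2 \<Rightarrow> real \<Rightarrow> complex" where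
  "sobolev_ft s g \<xi> = of_real (bracket \<xi> powr (- s)) * rep_L2 g \<xi>"

lemma L2_rel_rep: "L2_rel (rep_L2 g) (rep_L2 g)"
  by (rule Quotient_rep_reflp[OF Quotient_L2])

lemma norm_L2_sobolev:
  "norm g = sqrt (LINT \<xi>|lborel. (bracket \<xi> powr s * cmod (sobolev_ft s g \<xi>))\<^sup>2)"
proof -
  have "bracket \<xi> powr s * cmod (sobolev_ft s g \<xi>) = cmod (rep_L2 g \<xi>)" for \<xi>
  proof -
    have "bracket \<xi> > 0" by (simp add: bracket_def add_pos_nonneg)
    then have "bracket \<xi> powr s * bracket \<xi> powr (- s) = 1"
      by (simp flip: powr_add)
    then show ?thesis
      by (simp add: sobolev_ft_def norm_mult flip: mult.assoc)
  qed
  moreover have "inner g g = (LINT \<xi>|lborel. inner (rep_L2 g \<xi>) (rep_L2 g \<xi>))"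
    unfolding inner_L2_def by simp
  ultimately show ?thesis
    by (simp add: norm_L2_def power2_norm_eq_inner)
qed

lemma sobolev_ft_ex1:
  assumes "f \<in> borel_measurable borel"
    and "integrable lborel (\<lambda>\<xi>. (bracket \<xi> powr s * cmod (f \<xi>))\<^sup>2)"
  shows "\<exists>!g. AE \<xi> in lborel. sobolev_ft s g \<xi> = f \<xi>"
proof -
  define h where "h = (\<lambda>\<xi>. complex_of_real (bracket \<xi> powr s) * f \<xi>)"
  have pos: "bracket \<xi> > 0" for \<xi> by (simp add: bracket_def add_pos_nonneg)
  have canc: "bracket \<xi> powr (- s) * bracket \<xi> powr s = 1" for \<xi>
    using pos[of \<xi>] by (simp flip: powr_add)
  have key: "sobolev_ft s g \<xi> = f \<xi> \<longleftrightarrow> rep_L2 g \<xi> = h \<xi>" for g \<xi>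
  proof
    assume "sobolev_ft s g \<xi> = f \<xi>"
    then have "h \<xi> = of_real (bracket \<xi> powr (- s) * bracket \<xi> powr s) * rep_L2 g \<xi>"
      by (simp add: h_def sobolev_ft_def flip: \<open>_ = f \<xi>\<close>)
    then show "rep_L2 g \<xi> = h \<xi>" by (simp only: canc) simp
  next
    assume "rep_L2 g \<xi> = h \<xi>"
    then have "sobolev_ft s g \<xi> = of_real (bracket \<xi> powr (- s) * bracket \<xi> powr s) * f \<xi>"
      by (simp add: h_def sobolev_ft_def)
    then show "sobolev_ft s g \<xi> = f \<xi>" by (simp only: canc) simp
  qed
  have "bracket \<in> borel_measurable borel"
    unfolding bracket_def by measurable
  with assms have h: "square_integrable h"
    by (simp add: square_integrable_def h_def norm_mult)
  have "(AE \<xi> in lborel. rep_L2 g \<xi> = h \<xi>) \<longleftrightarrow> L2_rel (rep_L2 g) h" for g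
    using h L2_rel_rep[of g] by (auto simp: L2_rel_def)
  moreover have "L2_rel (rep_L2 g) h \<longleftrightarrow> g = abs_L2 h" for g
    using h Quotient_rel[OF Quotient_L2, of "rep_L2 g" h] L2_rel_rep[of g]
      Quotient_abs_rep[OF Quotient_L2, of g]
    by (auto simp: L2_rel_def)
  ultimately show ?thesis
    unfolding key by simp
qed

text \<open>
  \<open>C([0,T] : H\<^sup>s)\<close>: a continuous curve on the interval is extended to the line by its end point
  values, so that the norm of the library type of bounded continuous functions is the supremum
  over \<open>[0,T]\<close>. As above, the index s enters only through \<open>sobolev_ft s\<close>.
\<close>

definition curves :: "real \<Rightarrow> (real \<Rightarrow>\<^sub>C L2) set" where
  "curves T = {u. \<forall>t. apply_bcontfun u t = apply_bcontfun u (max 0 (min t T))}"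


section \<open>The initial value problem\<close>

definition gam :: "real \<Rightarrow> real" where
  "gam \<xi> = sqrt (\<xi>\<^sup>2 + \<xi> ^ 4)"

text \<open>Fourier multipliers of \<open>V\<^sub>c(t)\<close> and \<open>V\<^sub>s(t)\<close>; division by zero gives the
  latter the value 0 at the single frequency 0, which is immaterial.\<close>

definition Vc :: "real \<Rightarrow> real \<Rightarrow> complex" where
  "Vc t \<xi> = (exp (\<i> * of_real (t * gam \<xi>)) + exp (- \<i> * of_real (t * gam \<xi>))) / 2"

definition Vs :: "real \<Rightarrow> real \<Rightarrow> complex" where
  "Vs t \<xi> = (exp (\<i> * of_real (t * gam \<xi>)) - exp (- \<i> * of_real (t * gam \<xi>)))
              / (2 * \<i> * of_real (gam \<xi>))"

text \<open>
  \<open>square_ft f\<close> is the Fourier transform of the pointwise square of the function with Fourier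
  transform f, for the normalisation \<open>f\<^sup>\<and>(\<xi>) = \<integral> f(x) exp(-i x \<xi>) dx\<close>.
\<close>

definition square_ft :: "(real \<Rightarrow> complex) \<Rightarrow> real \<Rightarrow> complex" where
  "square_ft f \<xi> = of_real (1 / (2 * pi)) * (LINT \<eta>|lborel. f (\<xi> - \<eta>) * f \<eta>)"

definition cutoff :: "real \<Rightarrow> (real \<Rightarrow> complex) \<Rightarrow> real \<Rightarrow> complex" where
  "cutoff N f \<xi> = (if \<bar>\<xi>\<bar> \<le> N then f \<xi> else 0)"

definition linear_part :: "real \<Rightarrow> L2 \<times> L2 \<Rightarrow> real \<Rightarrow> real \<Rightarrow> complex" where
  "linear_part s z t \<xi> =
     Vc t \<xi> * sobolev_ft s (fst z) \<xi>
     + Vs t \<xi> * (\<i> * of_real \<xi> * sobolev_ft (s - 1) (snd z) \<xi>)"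

definition duhamel_part :: "real \<Rightarrow> real \<Rightarrow> (real \<Rightarrow> L2) \<Rightarrow> real \<Rightarrow> real \<Rightarrow> complex" where
  "duhamel_part s N u t \<xi> =
     (LINT t':{0..t}|lborel.
        Vs (t - t') \<xi> * ((\<i> * of_real \<xi>)\<^sup>2 * square_ft (cutoff N (sobolev_ft s (u t'))) \<xi>))"

definition schwartz :: "(real \<Rightarrow> complex) \<Rightarrow> bool" where
  "schwartz \<theta> \<longleftrightarrow>
     (\<exists>D. D 0 = \<theta> \<and>
       (\<forall>j x. (D j has_vector_derivative D (Suc j) x) (at x)) \<and>
       (\<forall>j k. bounded (range (\<lambda>x. x ^ k *\<^sub>R D j x))))"

text \<open>
  The integral equation, with data \<open>z = (\<phi>, \<psi>)\<close>, as an identity of tempered distributions for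
  each t. For s < 0 the square of a curve in \<open>H\<^sup>s\<close> has no pointwise meaning; the nonlinear term is
  the distributional limit of the nonlinear terms of the frequency truncations of u, whose squares
  are honest functions. For regular u this is the ordinary square.
\<close>

definition is_solution :: "real \<Rightarrow> real \<Rightarrow> L2 \<times> L2 \<Rightarrow> (real \<Rightarrow>\<^sub>C L2) \<Rightarrow> bool" where
  "is_solution s T z u \<longleftrightarrow>
     (\<forall>t\<in>{0..T}. \<forall>\<theta>. schwartz \<theta> \<longrightarrow>
        ((\<lambda>N. LINT \<xi>|lborel.
            \<theta> \<xi> * (linear_part s z t \<xi> - duhamel_part s N (apply_bcontfun u) t \<xi>))
         \<longlongrightarrow> (LINT \<xi>|lborel. \<theta> \<xi> * sobolev_ft s (apply_bcontfun u t) \<xi>)) at_top)"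

text \<open>\<open>u \<in> C([0,T] : H\<^sup>\<sigma>)\<close> for every \<open>\<sigma>\<close>.\<close>

definition smooth_curve :: "real \<Rightarrow> real \<Rightarrow> (real \<Rightarrow>\<^sub>C L2) \<Rightarrow> bool" where
  "smooth_curve s T u \<longleftrightarrow>
     (\<forall>\<sigma>. \<exists>v\<in>curves T. \<forall>t\<in>{0..T}. AE \<xi> in lborel.
        sobolev_ft \<sigma> (apply_bcontfun v t) \<xi> = sobolev_ft s (apply_bcontfun u t) \<xi>)"

text \<open>
  X is the class in which solutions are sought and are unique, a part of \<open>C([0,T] : H\<^sup>s)\<close> that
  misses no classical solution: e.g. all of \<open>C([0,T] : H\<^sup>s)\<close>, or a Bourgain space.
\<close>

definition flow_map :: "real \<Rightarrow> real \<Rightarrow> (real \<Rightarrow>\<^sub>C L2) set \<Rightarrow> L2 \<times> L2 \<Rightarrow> (real \<Rightarrow>\<^sub>C L2)" where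
  "flow_map s T X z = (THE u. u \<in> X \<and> is_solution s T z u)"

definition locally_well_posed :: "real \<Rightarrow> real \<Rightarrow> (real \<Rightarrow>\<^sub>C L2) set \<Rightarrow> bool" where
  "locally_well_posed s T X \<longleftrightarrow>
     X \<subseteq> curves T \<and>
     (\<forall>z. \<forall>u\<in>curves T. smooth_curve s T u \<and> is_solution s T z u \<longrightarrow> u \<in> X) \<and>
     (\<forall>z. \<exists>!u. u \<in> X \<and> is_solution s T z u) \<and>
     continuous_on UNIV (flow_map s T X)"

text \<open>Real Frechet derivatives: a map that is not \<open>C\<^sup>2\<close> over the reals is not so over the complexes.\<close>

definition C2_at :: "('a::real_normed_vector \<Rightarrow> 'b::real_normed_vector) \<Rightarrow> 'a \<Rightarrow> bool" where
  "C2_at f x \<longleftrightarrow>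
     (\<exists>U (f' :: 'a \<Rightarrow> 'a \<Rightarrow>\<^sub>L 'b) (f'' :: 'a \<Rightarrow> 'a \<Rightarrow>\<^sub>L ('a \<Rightarrow>\<^sub>L 'b)).
        open U \<and> x \<in> U \<and>
        (\<forall>y\<in>U. (f has_derivative blinfun_apply (f' y)) (at y)) \<and>
        (\<forall>y\<in>U. (f' has_derivative blinfun_apply (f'' y)) (at y)) \<and>
        continuous_on U f'')"

end

theory Submission
  imports Defs "HOL-Probability.Sinc_Integral" "HOL-Real_Asymp.Real_Asymp"
begin

text \<open>
  A flow map S that is \<open>C\<^sup>2\<close> at zero satisfies
  \<open>\<parallel>S(2z) - 2 S(z) + S(0)\<parallel> \<le> M \<parallel>z\<parallel>\<^sup>2\<close> for all small z, with one constant M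
  (\<open>C2_at_second_difference\<close>). On the Fourier side the solution with small data \<open>e z\<close> is
  \<open>e W - e\<^sup>2 D + O(e\<^sup>3)\<close>, where W is the free wave with data z and D is the Duhamel integral
  of its square; so the second difference at \<open>e z\<close> is \<open>- 2 e\<^sup>2 D + O(e\<^sup>3)\<close>, and D has to be
  bounded by a multiple of \<open>\<parallel>z\<parallel>\<^sup>2\<close>.

  This fails for \<open>s < -2\<close> by an interaction of high frequencies that produces a low one. Let
  the Fourier transform of \<open>\<phi>\<close> be a bump at \<open>N\<close> plus a bump at \<open>-N\<close>, and let \<open>\<psi> = 0\<close>. The norm
  of the data is about \<open>N\<^sup>s\<close>. Up to the time \<open>t = 1 / (N + 2)\<^sup>2\<close> no phase \<open>t \<gamma>(\<xi>)\<close> at the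
  frequencies involved exceeds 1, so that nothing oscillates, all contributions to D have the same
  sign, and \<open>|D|\<close> is at least a constant times \<open>t\<^sup>2\<close> at the frequencies in \<open>[1/4, 1/2]\<close>, where the
  \<open>H\<^sup>s\<close> weight is bounded below (\<open>duhamel_tent_wave_ge\<close>). Hence \<open>N\<^sup>-\<^sup>4\<close> would be bounded by a multiple
  of \<open>N\<^sup>2\<^sup>s\<close>, which is false for large N.

  The expansion needs solutions that are known well enough, and local well-posedness identifies
  only smooth solutions with values of the flow map. Such solutions are constructed by a
  contraction argument (\<open>ex_integral_equation\<close>) among the functions of time and frequency that are
  bounded by a multiple of the weight \<open>w(\<xi>) = exp(-|\<xi>|) / (1 + \<xi>\<^sup>2)\<close>. Two facts make this
  space suitable: the multiplier \<open>\<xi>\<^sup>2 sin(t \<gamma>(\<xi>)) / \<gamma>(\<xi>)\<close> of the Duhamel term is bounded by 1,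
  so that the nonlinearity loses no derivatives, and \<open>w * w \<le> 4 \<pi> w\<close>, so that the space is closed
  under the convolution by which squares act. The exponential decay puts the solutions in every
  \<open>H\<^sup>\<sigma>\<close>, and the datum, being compactly supported in frequency, is dominated by the weight.
\<close>

section \<open>Sobolev elements given by their Fourier transform\<close>

lemma bracket_pos [simp]: "0 < bracket \<xi>"
  by (simp add: bracket_def add_pos_nonneg)

lemma bracket_neq_0 [simp]: "bracket \<xi> \<noteq> 0"
  by (metis bracket_pos less_irrefl)

lemma bracket_ge_1: "1 \<le> bracket \<xi>"
  by (simp add: bracket_def)

lemma bracket_measurable [measurable]: "bracket \<in> borel_measurable borel"
  unfolding bracket_def by measurable

lemma sobolev_ft_measurable [measurable]: "sobolev_ft \<sigma> g \<in> borel_measurable borel"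
proof -
  have [measurable]: "rep_L2 g \<in> borel_measurable borel"
    using L2_rel_rep[of g] by (simp add: L2_rel_def square_integrable_def)
  show ?thesis
    unfolding sobolev_ft_def by measurable
qed

lemma sobolev_ft_add:
  "AE \<xi> in lborel. sobolev_ft \<sigma> (a + b) \<xi> = sobolev_ft \<sigma> a \<xi> + sobolev_ft \<sigma> b \<xi>"
proof -
  let ?f = "\<lambda>x. rep_L2 a x + rep_L2 b x"
  have "L2_rel ?f ?f"
    using L2_rel_rep[of a] L2_rel_rep[of b]
    by (auto simp: L2_rel_def intro: square_integrable_add)
  then have "L2_rel (rep_L2 (abs_L2 ?f)) ?f"
    by (rule Quotient_rep_abs[OF Quotient_L2])
  moreover have "a + b = abs_L2 ?f"
    by (simp add: plus_L2_def)
  ultimately have "AE x in lborel. rep_L2 (a + b) x = ?f x"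
    by (simp add: L2_rel_def)
  then show ?thesis
    by eventually_elim (simp add: sobolev_ft_def algebra_simps)
qed

lemma sobolev_ft_scaleR:
  "AE \<xi> in lborel. sobolev_ft \<sigma> (c *\<^sub>R a) \<xi> = c *\<^sub>R sobolev_ft \<sigma> a \<xi>"
proof -
  let ?f = "\<lambda>x. c *\<^sub>R rep_L2 a x"
  have "L2_rel ?f ?f"
    using L2_rel_rep[of a] by (auto simp: L2_rel_def intro: square_integrable_scaleR)
  then have "L2_rel (rep_L2 (abs_L2 ?f)) ?f"
    by (rule Quotient_rep_abs[OF Quotient_L2])
  moreover have "c *\<^sub>R a = abs_L2 ?f"
    by (simp add: scaleR_L2_def)
  ultimately have "AE x in lborel. rep_L2 (c *\<^sub>R a) x = ?f x"
    by (simp add: L2_rel_def)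
  then show ?thesis
    by eventually_elim (simp add: sobolev_ft_def algebra_simps)
qed

lemma sobolev_ft_diff:
  "AE \<xi> in lborel. sobolev_ft \<sigma> (a - b) \<xi> = sobolev_ft \<sigma> a \<xi> - sobolev_ft \<sigma> b \<xi>"
proof -
  have "a - b = a + (-1) *\<^sub>R b"
    by simp
  then show ?thesis
    using sobolev_ft_add[of \<sigma> a "(-1) *\<^sub>R b"] sobolev_ft_scaleR[of \<sigma> "-1" b]
    by (auto elim: eventually_elim2)
qed

lemma sobolev_ft_zero: "AE \<xi> in lborel. sobolev_ft \<sigma> 0 \<xi> = 0"
  using sobolev_ft_scaleR[of \<sigma> 0 0] by simp

lemma norm_sobolev_eq:
  assumes "AE \<xi> in lborel. sobolev_ft \<sigma> g \<xi> = f \<xi>" and [measurable]: "f \<in> borel_measurable borel"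
  shows "(norm g)\<^sup>2 = (LINT \<xi>|lborel. (bracket \<xi> powr \<sigma> * cmod (f \<xi>))\<^sup>2)"
proof -
  have "(LINT \<xi>|lborel. (bracket \<xi> powr \<sigma> * cmod (sobolev_ft \<sigma> g \<xi>))\<^sup>2)
      = (LINT \<xi>|lborel. (bracket \<xi> powr \<sigma> * cmod (f \<xi>))\<^sup>2)"
    by (rule integral_cong_AE) (use assms in \<open>auto elim: eventually_mono\<close>)
  then show ?thesis
    by (simp add: norm_L2_sobolev[of g \<sigma>])
qed

lemma sobolev_ft_integrable:
  "integrable lborel (\<lambda>\<xi>. (bracket \<xi> powr \<sigma> * cmod (sobolev_ft \<sigma> g \<xi>))\<^sup>2)"
proof -
  have "bracket \<xi> powr \<sigma> * bracket \<xi> powr (- \<sigma>) = 1" for \<xi>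
    by (simp flip: powr_add)
  then have "bracket \<xi> powr \<sigma> * cmod (sobolev_ft \<sigma> g \<xi>) = cmod (rep_L2 g \<xi>)" for \<xi>
    by (simp add: sobolev_ft_def norm_mult flip: mult.assoc)
  then show ?thesis
    using L2_rel_rep[of g] by (simp add: L2_rel_def square_integrable_def)
qed

definition sobolev_of_ft :: "real \<Rightarrow> (real \<Rightarrow> complex) \<Rightarrow> L2" where
  "sobolev_of_ft \<sigma> f = (THE g. AE \<xi> in lborel. sobolev_ft \<sigma> g \<xi> = f \<xi>)"

lemma sobolev_ft_of_ft:
  assumes "f \<in> borel_measurable borel"
    and "integrable lborel (\<lambda>\<xi>. (bracket \<xi> powr \<sigma> * cmod (f \<xi>))\<^sup>2)"
  shows "AE \<xi> in lborel. sobolev_ft \<sigma> (sobolev_of_ft \<sigma> f) \<xi> = f \<xi>"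
  unfolding sobolev_of_ft_def by (rule theI'[OF sobolev_ft_ex1[OF assms]])

section \<open>A convolution-stable weight\<close>

text \<open>
  The factor \<open>exp(-|\<xi>|)\<close> is submultiplicative along \<open>\<xi> = (\<xi> - \<eta>) + \<eta>\<close> and gives decay faster than
  any power. The factor \<open>1 / (1 + \<xi>\<^sup>2)\<close> keeps the convolution of the weight with itself below a
  multiple of the weight; without it the convolution would be larger by a factor of order \<open>1 + |\<xi>|\<close>.
\<close>

definition weight :: "real \<Rightarrow> real" where
  "weight \<xi> = exp (- \<bar>\<xi>\<bar>) / (1 + \<xi>\<^sup>2)"

lemma one_plus_square_pos [simp]: "0 < 1 + (x::real)\<^sup>2"
  by (simp add: add_pos_nonneg)

lemma one_plus_square_neq_0 [simp]: "1 + (x::real)\<^sup>2 \<noteq> 0"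
  by (metis one_plus_square_pos less_irrefl)

lemma weight_pos: "0 < weight \<xi>"
  by (simp add: weight_def)

lemma weight_le_1: "weight \<xi> \<le> 1"
proof -
  have "exp (- \<bar>\<xi>\<bar>) \<le> 1" by simp
  also have "1 \<le> 1 + \<xi>\<^sup>2" by simp
  finally show ?thesis by (simp add: weight_def)
qed

lemma weight_le_inverse: "weight \<xi> \<le> inverse (1 + \<xi>\<^sup>2)"
  by (simp add: weight_def divide_inverse)

lemma continuous_on_weight [continuous_intros]:
  assumes "continuous_on S f"
  shows "continuous_on S (\<lambda>x. weight (f x))"
  unfolding weight_def
  by (intro continuous_intros assms) simp

lemma weight_measurable [measurable]: "weight \<in> borel_measurable borel"
  unfolding weight_def by measurable

lemma integrable_inverse_one_plus_square: "integrable lborel (\<lambda>x::real. inverse (1 + x\<^sup>2))"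
  using integrable_inverse_1_plus_square by (simp add: set_integrable_def)

lemma integral_inverse_one_plus_square: "(LINT x|lborel. inverse (1 + x\<^sup>2)) = pi"
  using LBINT_inverse_1_plus_square
  by (simp add: interval_lebesgue_integral_def set_lebesgue_integral_def)

lemma integrable_weight: "integrable lborel weight"
  by (rule Bochner_Integration.integrable_bound[OF integrable_inverse_one_plus_square])
    (use weight_pos weight_le_inverse in \<open>auto simp: less_imp_le abs_of_pos\<close>)

text \<open>
  One of the frequencies \<open>\<xi> - \<eta>\<close>, \<open>\<eta>\<close> is comparable to \<open>\<xi>\<close>; its factor is traded for the weight at
  \<open>\<xi>\<close> and the other one is left as an integrable function of \<open>\<eta>\<close>.
\<close>

lemma weight_mult_le:
  "weight (\<xi> - \<eta>) * weight \<eta>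
     \<le> 2 * weight \<xi> * (inverse (1 + \<eta>\<^sup>2) + inverse (1 + (\<xi> - \<eta>)\<^sup>2))"
proof -
  let ?a = "1 + (\<xi> - \<eta>)\<^sup>2" and ?b = "1 + \<eta>\<^sup>2" and ?c = "1 + \<xi>\<^sup>2"
  have pos: "?a > 0" "?b > 0" "?c > 0"
    by simp_all
  have "0 \<le> (\<xi> - 2 * \<eta>)\<^sup>2" by simp
  then have *: "?c \<le> 2 * (?a + ?b)"
    by (simp add: power2_eq_square algebra_simps)
  have "exp (- \<bar>\<xi> - \<eta>\<bar>) * exp (- \<bar>\<eta>\<bar>) = exp (- \<bar>\<xi> - \<eta>\<bar> - \<bar>\<eta>\<bar>)"
    by (simp add: exp_diff exp_minus divide_inverse)
  also have "\<dots> \<le> exp (- \<bar>\<xi>\<bar>)"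
    by simp
  finally have "weight (\<xi> - \<eta>) * weight \<eta> \<le> exp (- \<bar>\<xi>\<bar>) * (1 / (?a * ?b))"
    using pos by (simp add: weight_def divide_right_mono)
  also have "1 / (?a * ?b) \<le> 2 / ?c * (inverse ?b + inverse ?a)"
  proof -
    have "1 / (?a * ?b) = ?c / (?c * ?a * ?b)"
      using pos(3) by simp
    also have "\<dots> \<le> 2 * (?a + ?b) / (?c * ?a * ?b)"
      using * pos by (intro divide_right_mono) auto
    also have "\<dots> = 2 / ?c * (inverse ?b + inverse ?a)"
      using pos by (simp add: field_simps)
    finally show ?thesis .
  qed
  then have "exp (- \<bar>\<xi>\<bar>) * (1 / (?a * ?b)) \<le> exp (- \<bar>\<xi>\<bar>) * (2 / ?c * (inverse ?b + inverse ?a))"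
    by (intro mult_left_mono) auto
  also have "\<dots> = 2 * weight \<xi> * (inverse ?b + inverse ?a)"
    by (simp add: weight_def)
  finally show ?thesis .
qed

lemma integrable_inverse_one_plus_square_shift:
  "integrable lborel (\<lambda>\<eta>::real. inverse (1 + (\<xi> - \<eta>)\<^sup>2))"
  using lborel_integrable_real_affine[OF integrable_inverse_one_plus_square, of "-1" \<xi>] by simp

lemma integral_inverse_one_plus_square_shift:
  "(LINT \<eta>|lborel. inverse (1 + (\<xi> - \<eta>)\<^sup>2)) = pi"
  using lborel_integral_real_affine[of "-1" "\<lambda>x. inverse (1 + x\<^sup>2)" \<xi>]
  by (simp add: integral_inverse_one_plus_square)

lemma integrable_weight_mult: "integrable lborel (\<lambda>\<eta>. weight (\<xi> - \<eta>) * weight \<eta>)"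
proof (rule Bochner_Integration.integrable_bound[OF integrable_weight])
  show "AE \<eta> in lborel. norm (weight (\<xi> - \<eta>) * weight \<eta>) \<le> norm (weight \<eta>)"
    using weight_le_1 weight_pos by (auto simp: abs_mult abs_of_pos intro!: mult_left_le_one_le less_imp_le)
qed simp

lemma weight_conv_le: "(LINT \<eta>|lborel. weight (\<xi> - \<eta>) * weight \<eta>) \<le> 4 * pi * weight \<xi>"
proof -
  have "(LINT \<eta>|lborel. weight (\<xi> - \<eta>) * weight \<eta>)
      \<le> (LINT \<eta>|lborel. 2 * weight \<xi> * (inverse (1 + \<eta>\<^sup>2) + inverse (1 + (\<xi> - \<eta>)\<^sup>2)))"
    by (intro integral_mono integrable_weight_mult weight_mult_le integrable_mult_right
        Bochner_Integration.integrable_add integrable_inverse_one_plus_square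
        integrable_inverse_one_plus_square_shift)
  also have "\<dots> = 4 * pi * weight \<xi>"
    by (simp add: integrable_inverse_one_plus_square integrable_inverse_one_plus_square_shift
        integral_inverse_one_plus_square integral_inverse_one_plus_square_shift)
  finally show ?thesis .
qed

text \<open>
  From \<open>ln y \<le> y - 1\<close> at \<open>y = \<langle>\<xi>\<rangle> / a\<close>; the maximum with 1 in the choice of a keeps a positive.
\<close>

lemma bracket_powr_le_exp:
  obtains C where "\<And>\<xi>. bracket \<xi> powr \<sigma> \<le> C * exp \<bar>\<xi>\<bar>" "C > 0"
proof -
  define a where "a = max 1 \<sigma>"
  have a: "a \<ge> 1" "a \<ge> \<sigma>" by (auto simp: a_def)
  have "bracket \<xi> powr \<sigma> \<le> exp (1 - a + a * ln a) * exp \<bar>\<xi>\<bar>" for \<xi>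
  proof -
    have "ln (bracket \<xi> / a) \<le> bracket \<xi> / a - 1"
      using a by (intro ln_le_minus_one) auto
    then have "a * ln (bracket \<xi> / a) \<le> a * (bracket \<xi> / a - 1)"
      using a by (intro mult_left_mono) auto
    then have "a * ln (bracket \<xi>) \<le> bracket \<xi> - a + a * ln a"
      using a bracket_neq_0[of \<xi>] by (simp add: ln_div algebra_simps)
    moreover have "\<sigma> * ln (bracket \<xi>) \<le> a * ln (bracket \<xi>)"
      using a bracket_ge_1[of \<xi>] by (intro mult_right_mono) auto
    ultimately have "\<sigma> * ln (bracket \<xi>) \<le> (1 - a + a * ln a) + \<bar>\<xi>\<bar>"
      by (simp add: bracket_def)
    then have "exp (\<sigma> * ln (bracket \<xi>)) \<le> exp ((1 - a + a * ln a) + \<bar>\<xi>\<bar>)"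
      by simp
    then show ?thesis
      using bracket_pos[of \<xi>] by (simp add: powr_def exp_add)
  qed
  then show ?thesis
    by (rule that) simp
qed

lemma integrable_bracket_weight: "integrable lborel (\<lambda>\<xi>. (bracket \<xi> powr \<sigma> * weight \<xi>)\<^sup>2)"
proof -
  obtain C where C: "\<And>\<xi>. bracket \<xi> powr \<sigma> \<le> C * exp \<bar>\<xi>\<bar>" "C > 0"
    using bracket_powr_le_exp[of \<sigma>] by blast
  have "(bracket \<xi> powr \<sigma> * weight \<xi>)\<^sup>2 \<le> C\<^sup>2 * inverse (1 + \<xi>\<^sup>2)" for \<xi>
  proof -
    have "bracket \<xi> powr \<sigma> * weight \<xi> \<le> C * exp \<bar>\<xi>\<bar> * weight \<xi>"
      using C(1) weight_pos by (intro mult_right_mono) (auto intro: less_imp_le)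
    also have "\<dots> = C * (exp \<bar>\<xi>\<bar> * exp (- \<bar>\<xi>\<bar>)) * inverse (1 + \<xi>\<^sup>2)"
      by (simp add: weight_def divide_inverse)
    also have "\<dots> = C * inverse (1 + \<xi>\<^sup>2)"
      by (simp add: exp_minus)
    finally have "(bracket \<xi> powr \<sigma> * weight \<xi>)\<^sup>2 \<le> (C * inverse (1 + \<xi>\<^sup>2))\<^sup>2"
      using weight_pos by (intro power_mono) (auto intro: less_imp_le)
    also have "\<dots> = C\<^sup>2 * (inverse (1 + \<xi>\<^sup>2) * inverse (1 + \<xi>\<^sup>2))"
      by (simp add: power2_eq_square)
    also have "\<dots> \<le> C\<^sup>2 * inverse (1 + \<xi>\<^sup>2)"
      by (intro mult_left_mono mult_left_le_one_le) (auto simp: inverse_le_1_iff)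
    finally show ?thesis .
  qed
  then show ?thesis
    by (intro Bochner_Integration.integrable_bound
        [OF integrable_mult_right[OF integrable_inverse_one_plus_square, of "C\<^sup>2"]])
      (auto intro: order_trans)
qed

section \<open>The Duhamel operator on dominated symbols\<close>

lemma continuous_on_integral_dominated:
  fixes f :: "'p::{first_countable_topology, t2_space} \<Rightarrow> 'x \<Rightarrow> 'b::{banach, second_countable_topology}"
  assumes "\<And>x. x \<in> space M \<Longrightarrow> continuous_on UNIV (\<lambda>p. f p x)" "\<And>p. f p \<in> borel_measurable M"
    and "\<And>p x. norm (f p x) \<le> g x" "integrable M g"
  shows "continuous_on UNIV (\<lambda>p. LINT x|M. f p x)"
proof (rule continuous_on_sequentiallyI)
  fix u :: "nat \<Rightarrow> 'p" and a assume u: "u \<longlonglongrightarrow> a"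
  show "(\<lambda>n. LINT x|M. f (u n) x) \<longlonglongrightarrow> (LINT x|M. f a x)"
  proof (rule integral_dominated_convergence[where w = g])
    show "AE x in M. (\<lambda>n. f (u n) x) \<longlonglongrightarrow> f a x"
      using assms(1) u
      by (auto intro!: AE_I2 continuous_on_tendsto_compose[where f = "\<lambda>p. f p _" and s = UNIV])
  qed (use assms in auto)
qed

text \<open>
  In this form the multipliers below are seen to be bounded and continuous also at frequency 0,
  where \<open>\<gamma>\<close> vanishes.
\<close>

lemma gam_eq: "gam \<xi> = \<bar>\<xi>\<bar> * sqrt (1 + \<xi>\<^sup>2)"
proof -
  have "\<xi>\<^sup>2 + \<xi> ^ 4 = \<xi>\<^sup>2 * (1 + \<xi>\<^sup>2)"
    by (simp add: algebra_simps power2_eq_square power4_eq_xxxx)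
  then show ?thesis
    by (simp add: gam_def real_sqrt_mult)
qed

lemma exp_i_eq_cis:
  "exp (\<i> * of_real x) = cis x" "exp (- \<i> * of_real x) = cis (- x)"
  by (simp_all add: cis_conv_exp)

lemma Vc_eq: "Vc t \<xi> = of_real (cos (t * gam \<xi>))"
  unfolding Vc_def exp_i_eq_cis by (simp add: complex_eq_iff)

lemma Vs_eq: "Vs t \<xi> = of_real (sin (t * gam \<xi>) / gam \<xi>)"
proof -
  have "cis x - cis (- x) = 2 * \<i> * of_real (sin x)" for x
    by (simp add: complex_eq_iff)
  then show ?thesis
    unfolding Vs_def exp_i_eq_cis by simp
qed

definition duhamel_kernel :: "real \<Rightarrow> real \<Rightarrow> complex" where
  "duhamel_kernel t \<xi> = Vs t \<xi> * (\<i> * of_real \<xi>)\<^sup>2"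

lemma duhamel_kernel_eq:
  "duhamel_kernel t \<xi> = - of_real (\<bar>\<xi>\<bar> / sqrt (1 + \<xi>\<^sup>2) * sin (t * gam \<xi>))"
proof -
  have "\<xi>\<^sup>2 / gam \<xi> = (\<bar>\<xi>\<bar> * \<bar>\<xi>\<bar>) / (\<bar>\<xi>\<bar> * sqrt (1 + \<xi>\<^sup>2))"
    by (simp add: gam_eq power2_eq_square)
  also have "\<dots> = \<bar>\<xi>\<bar> / sqrt (1 + \<xi>\<^sup>2)"
    by (cases "\<xi> = 0") (simp_all del: abs_mult_self_eq)
  finally have "\<xi>\<^sup>2 / gam \<xi> = \<bar>\<xi>\<bar> / sqrt (1 + \<xi>\<^sup>2)" .
  then have "sin (t * gam \<xi>) / gam \<xi> * \<xi>\<^sup>2 = \<bar>\<xi>\<bar> / sqrt (1 + \<xi>\<^sup>2) * sin (t * gam \<xi>)"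
    by (metis (no_types) mult.commute times_divide_eq_right)
  moreover have "duhamel_kernel t \<xi> = - of_real (sin (t * gam \<xi>) / gam \<xi> * \<xi>\<^sup>2)"
    by (simp add: duhamel_kernel_def Vs_eq power_mult_distrib)
  ultimately show ?thesis
    by simp
qed

lemma norm_duhamel_kernel_le_1: "cmod (duhamel_kernel t \<xi>) \<le> 1"
proof -
  have "\<bar>\<xi>\<bar> \<le> sqrt (1 + \<xi>\<^sup>2)"
    by (rule real_le_rsqrt) simp
  then have "\<bar>\<xi>\<bar> / sqrt (1 + \<xi>\<^sup>2) \<le> 1"
    by (simp add: divide_le_eq)
  then have "\<bar>\<xi>\<bar> / sqrt (1 + \<xi>\<^sup>2) * \<bar>sin (t * gam \<xi>)\<bar> \<le> 1 * 1"
    by (intro mult_mono) auto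
  then show ?thesis
    unfolding duhamel_kernel_eq norm_minus_cancel norm_of_real by (simp add: abs_mult)
qed

lemma duhamel_kernel_0 [simp]: "duhamel_kernel 0 \<xi> = 0"
  by (simp add: duhamel_kernel_eq)

lemma continuous_on_gam [continuous_intros]:
  "continuous_on S f \<Longrightarrow> continuous_on S (\<lambda>x. gam (f x))"
  unfolding gam_def by (intro continuous_intros)

lemma continuous_on_duhamel_kernel [continuous_intros]:
  fixes f g :: "'a::t2_space \<Rightarrow> real"
  assumes "continuous_on S f" "continuous_on S g"
  shows "continuous_on S (\<lambda>x. duhamel_kernel (f x) (g x))"
  unfolding duhamel_kernel_eq by (intro continuous_intros assms) simp

text \<open>
  The class of Fourier transforms in which the integral equation is solved. Joint continuity in
  time and frequency gives all measurability that iterated integrals need, and continuity in time.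
\<close>

definition dominated :: "real \<Rightarrow> (real \<Rightarrow> real \<Rightarrow> complex) \<Rightarrow> bool" where
  "dominated K G \<longleftrightarrow>
     continuous_on UNIV (\<lambda>p. G (fst p) (snd p)) \<and> (\<forall>t \<xi>. cmod (G t \<xi>) \<le> K * weight \<xi>)"

lemma dominated_norm_le: "dominated K G \<Longrightarrow> cmod (G t \<xi>) \<le> K * weight \<xi>"
  by (simp add: dominated_def)

lemma dominated_nonneg:
  assumes "dominated K G" shows "0 \<le> K"
proof -
  have "0 \<le> K * weight 0"
    using dominated_norm_le[OF assms, of 0 0] norm_ge_zero order_trans by blast
  then show ?thesis
    using weight_pos[of 0] by (simp add: zero_le_mult_iff)
qed

lemma dominated_continuous_on:
  assumes "dominated K G" "continuous_on S f" "continuous_on S g"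
  shows "continuous_on S (\<lambda>x. G (f x) (g x))"
  using continuous_on_compose2[of UNIV "\<lambda>p. G (fst p) (snd p)" S "\<lambda>x. (f x, g x)"] assms
  by (auto simp: dominated_def intro: continuous_on_Pair)

lemma dominated_measurable:
  assumes "dominated K G"
  shows "G t \<in> borel_measurable borel"
  by (intro borel_measurable_continuous_onI dominated_continuous_on[OF assms] continuous_intros)

lemma dominated_diff:
  assumes "dominated K G" "dominated K' G'"
  shows "dominated (K + K') (\<lambda>t \<xi>. G t \<xi> - G' t \<xi>)"
proof -
  have "cmod (G t \<xi> - G' t \<xi>) \<le> (K + K') * weight \<xi>" for t \<xi>
    using norm_triangle_ineq4[of "G t \<xi>" "G' t \<xi>"] dominated_norm_le[OF assms(1), of t \<xi>]
      dominated_norm_le[OF assms(2), of t \<xi>] by (simp add: algebra_simps)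
  then show ?thesis
    using assms by (auto simp: dominated_def intro!: continuous_intros)
qed

lemma dominated_add:
  assumes "dominated K G" "dominated K' G'"
  shows "dominated (K + K') (\<lambda>t \<xi>. G t \<xi> + G' t \<xi>)"
proof -
  have "cmod (G t \<xi> + G' t \<xi>) \<le> (K + K') * weight \<xi>" for t \<xi>
    using norm_triangle_ineq[of "G t \<xi>" "G' t \<xi>"] dominated_norm_le[OF assms(1), of t \<xi>]
      dominated_norm_le[OF assms(2), of t \<xi>] by (simp add: algebra_simps)
  then show ?thesis
    using assms by (auto simp: dominated_def intro!: continuous_intros)
qed

lemma dominated_scale:
  assumes "dominated K G"
  shows "dominated (\<bar>c\<bar> * K) (\<lambda>t \<xi>. of_real c * G t \<xi>)"
  using assms by (auto simp: dominated_def norm_mult mult.assoc intro!: continuous_intros mult_left_mono)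

text \<open>
  The polarisation of \<open>square_ft\<close>, which is needed to compare the squares of two functions.
\<close>

definition ft_prod :: "(real \<Rightarrow> complex) \<Rightarrow> (real \<Rightarrow> complex) \<Rightarrow> real \<Rightarrow> complex" where
  "ft_prod f g \<xi> = of_real (1 / (2 * pi)) * (LINT \<eta>|lborel. f (\<xi> - \<eta>) * g \<eta>)"

lemma square_ft_eq: "square_ft f = ft_prod f f"
  by (simp add: fun_eq_iff square_ft_def ft_prod_def)

lemma integrable_prod_weight:
  assumes [measurable]: "f \<in> borel_measurable borel" "g \<in> borel_measurable borel"
    and "\<And>\<xi>. cmod (f \<xi>) \<le> K * weight \<xi>" "\<And>\<xi>. cmod (g \<xi>) \<le> L * weight \<xi>"
  shows "integrable lborel (\<lambda>\<eta>. f (\<xi> - \<eta>) * g \<eta>)"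
    and "cmod (f (\<xi> - \<eta>) * g \<eta>) \<le> K * L * (weight (\<xi> - \<eta>) * weight \<eta>)"
proof -
  show *: "cmod (f (\<xi> - \<eta>) * g \<eta>) \<le> K * L * (weight (\<xi> - \<eta>) * weight \<eta>)" for \<eta>
  proof -
    have "cmod (f (\<xi> - \<eta>)) * cmod (g \<eta>) \<le> (K * weight (\<xi> - \<eta>)) * (L * weight \<eta>)"
      by (intro mult_mono assms norm_ge_zero order_trans[OF norm_ge_zero assms(3)])
    then show ?thesis
      by (simp add: norm_mult algebra_simps)
  qed
  show "integrable lborel (\<lambda>\<eta>. f (\<xi> - \<eta>) * g \<eta>)"
    by (rule Bochner_Integration.integrable_bound[OF integrable_mult_right[OF integrable_weight_mult, of "K * L" \<xi>]])
      (use * in \<open>auto intro!: AE_I2 order_trans[OF _ abs_ge_self]\<close>)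
qed

lemma norm_ft_prod_le:
  assumes "f \<in> borel_measurable borel" "g \<in> borel_measurable borel"
    and "\<And>\<xi>. cmod (f \<xi>) \<le> K * weight \<xi>" "\<And>\<xi>. cmod (g \<xi>) \<le> L * weight \<xi>"
  shows "cmod (ft_prod f g \<xi>) \<le> 2 * (K * L) * weight \<xi>"
proof -
  have KL: "0 \<le> K * L"
  proof -
    have "0 \<le> K * weight 0" "0 \<le> L * weight 0"
      using assms(3,4)[of 0] norm_ge_zero order_trans by blast+
    then show ?thesis
      using weight_pos[of 0] by (simp add: zero_le_mult_iff)
  qed
  have "cmod (LINT \<eta>|lborel. f (\<xi> - \<eta>) * g \<eta>) \<le> (LINT \<eta>|lborel. K * L * (weight (\<xi> - \<eta>) * weight \<eta>))"
    by (rule order_trans[OF integral_norm_bound integral_mono])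
      (use integrable_prod_weight[OF assms] integrable_weight_mult in auto)
  also have "\<dots> \<le> K * L * (4 * pi * weight \<xi>)"
    using weight_conv_le[of \<xi>] KL by (simp add: mult_left_mono)
  finally have "cmod (LINT \<eta>|lborel. f (\<xi> - \<eta>) * g \<eta>) / (2 * pi) \<le> K * L * (4 * pi * weight \<xi>) / (2 * pi)"
    by (intro divide_right_mono) auto
  then show ?thesis
    by (simp add: ft_prod_def norm_mult norm_divide)
qed

lemma norm_ft_prod_dominated:
  assumes "dominated K G" "dominated L H"
  shows "cmod (ft_prod (G t) (H t) \<xi>) \<le> 2 * (K * L) * weight \<xi>"
  using assms by (intro norm_ft_prod_le dominated_measurable[OF assms(1)] dominated_measurable[OF assms(2)])
    (simp_all add: dominated_norm_le)

lemma continuous_on_ft_prod: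
  assumes G: "dominated K G" and H: "dominated L H"
    and f: "continuous_on S f" "continuous_on S g"
  shows "continuous_on S (\<lambda>x. ft_prod (G (f x)) (H (f x)) (g x))"
proof -
  have "continuous_on UNIV (\<lambda>p. LINT \<eta>|lborel. G (fst p) (snd p - \<eta>) * H (fst p) \<eta>)"
  proof (rule continuous_on_integral_dominated)
    show "integrable lborel (\<lambda>\<eta>. K * (L * weight \<eta>))"
      using integrable_weight by simp
    show "continuous_on UNIV (\<lambda>p. G (fst p) (snd p - \<eta>) * H (fst p) \<eta>)" for \<eta>
      by (intro continuous_intros dominated_continuous_on[OF G] dominated_continuous_on[OF H])
    show "(\<lambda>\<eta>. G (fst p) (snd p - \<eta>) * H (fst p) \<eta>) \<in> borel_measurable lborel" for p
      using dominated_measurable[OF G, measurable] dominated_measurable[OF H, measurable] by measurable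
    show "cmod (G (fst p) (snd p - \<eta>) * H (fst p) \<eta>) \<le> K * (L * weight \<eta>)" for p \<eta>
    proof -
      have "cmod (G (fst p) (snd p - \<eta>)) \<le> K * 1"
        using dominated_norm_le[OF G] weight_le_1 dominated_nonneg[OF G]
        by (meson mult_left_mono order_trans)
      moreover have "cmod (H (fst p) \<eta>) \<le> L * weight \<eta>"
        by (rule dominated_norm_le[OF H])
      ultimately show ?thesis
        unfolding norm_mult using dominated_nonneg[OF G] by (intro mult_mono) auto
    qed
  qed
  then have "continuous_on S (\<lambda>x. LINT \<eta>|lborel. G (f x) (g x - \<eta>) * H (f x) \<eta>)"
    using continuous_on_compose2[of UNIV _ S "\<lambda>x. (f x, g x)"] f
    by (force intro: continuous_on_Pair)
  then show ?thesis
    unfolding ft_prod_def by (intro continuous_intros)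
qed

text \<open>
  The upper limit t of the Duhamel integral is moved into the kernel, which vanishes at time 0 and
  hence for \<open>r > t\<close> here. The integrand is then continuous in t on a fixed domain, and the operator
  is bounded for all real t, not only on the time interval.
\<close>

definition duhamel ::
  "real \<Rightarrow> (real \<Rightarrow> real \<Rightarrow> complex) \<Rightarrow> (real \<Rightarrow> real \<Rightarrow> complex) \<Rightarrow> real \<Rightarrow> real \<Rightarrow> complex" where
  "duhamel T G H t \<xi> =
     (LINT r:{0..T}|lborel. duhamel_kernel (max 0 (t - r)) \<xi> * ft_prod (G r) (H r) \<xi>)"

lemma set_integrable_duhamel:
  assumes G: "dominated K G" and H: "dominated L H"
  shows "set_integrable lborel {0..T}
    (\<lambda>r. duhamel_kernel (max 0 (t - r)) \<xi> * ft_prod (G r) (H r) \<xi>)"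
  unfolding set_integrable_def
  by (intro borel_integrable_compact continuous_intros continuous_on_ft_prod[OF G H]) auto

text \<open>
  The kernel is bounded by 1, the product of the two symbols costs the factor \<open>4 \<pi> / (2 \<pi>)\<close> of
  convolution, and time integration costs the factor T.
\<close>

lemma dominated_duhamel:
  assumes G: "dominated K G" and H: "dominated L H" and T: "0 \<le> T"
  shows "dominated (2 * T * K * L) (duhamel T G H)"
proof -
  let ?f = "\<lambda>t \<xi> r. duhamel_kernel (max 0 (t - r)) \<xi> * ft_prod (G r) (H r) \<xi>"
  have KL: "0 \<le> 2 * (K * L)"
    using dominated_nonneg[OF G] dominated_nonneg[OF H] by simp
  have bd: "cmod (?f t \<xi> r) \<le> 2 * (K * L) * weight \<xi>" for t \<xi> r
    unfolding norm_mult
    using mult_mono[OF norm_duhamel_kernel_le_1 norm_ft_prod_dominated[OF G H]]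
    by fastforce
  have "cmod (duhamel T G H t \<xi>) \<le> (2 * T * K * L) * weight \<xi>" for t \<xi>
  proof -
    have "cmod (duhamel T G H t \<xi>) \<le> (LINT r:{0..T}|lborel. cmod (?f t \<xi> r))"
      unfolding duhamel_def by (rule set_integral_norm_bound[OF set_integrable_duhamel[OF G H]])
    also have "\<dots> \<le> (LINT r:{0..T}|lborel. 2 * (K * L) * weight \<xi>)"
    proof (rule set_integral_mono[OF set_integrable_norm[OF set_integrable_duhamel[OF G H]] _ bd])
      show "set_integrable lborel {0..T} (\<lambda>r. 2 * (K * L) * weight \<xi>)"
        unfolding set_integrable_def by (rule borel_integrable_compact) auto
    qed
    also have "\<dots> = (2 * T * K * L) * weight \<xi>"
      using T by (simp add: set_lebesgue_integral_def)
    finally show ?thesis .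
  qed
  moreover have "continuous_on UNIV (\<lambda>p. duhamel T G H (fst p) (snd p))"
    unfolding duhamel_def set_lebesgue_integral_def
  proof (rule continuous_on_integral_dominated)
    show "integrable lborel (\<lambda>r. indicator {0..T} r * (2 * (K * L)))"
      using borel_integrable_compact[of "{0..T}" "\<lambda>_. 2 * (K * L)"] by simp
    show "continuous_on UNIV (\<lambda>p. indicator {0..T} r *\<^sub>R ?f (fst p) (snd p) r)" for r
      by (intro continuous_intros continuous_on_ft_prod[OF G H])
    show "(\<lambda>r. indicator {0..T} r *\<^sub>R ?f (fst p) (snd p) r) \<in> borel_measurable lborel" for p
      using set_integrable_duhamel[OF G H] by (auto simp: set_integrable_def)
    show "cmod (indicator {0..T} r *\<^sub>R ?f (fst p) (snd p) r) \<le> indicator {0..T} r * (2 * (K * L))" for p r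
      using order_trans[OF bd mult_left_mono[OF weight_le_1 KL]] by (auto simp: indicator_def)
  qed
  ultimately show ?thesis
    by (simp add: dominated_def)
qed

lemma ft_prod_dominated_diff:
  assumes "dominated K G" "dominated L H"
  shows "ft_prod (G t) (G t) \<xi> - ft_prod (H t) (H t) \<xi>
    = ft_prod (\<lambda>\<xi>. G t \<xi> - H t \<xi>) (G t) \<xi> + ft_prod (H t) (\<lambda>\<xi>. G t \<xi> - H t \<xi>) \<xi>"
proof -
  have int: "integrable lborel (\<lambda>\<eta>. A t (\<xi> - \<eta>) * B t \<eta>)" if "dominated a A" "dominated b B" for a b A B
    by (rule integrable_prod_weight(1)[OF dominated_measurable[OF that(1)] dominated_measurable[OF that(2)]
          dominated_norm_le[OF that(1)] dominated_norm_le[OF that(2)]])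
  show ?thesis
    unfolding ft_prod_def left_diff_distrib right_diff_distrib
    using int[OF assms(1,1)] int[OF assms(1,2)] int[OF assms(2,1)] int[OF assms(2,2)]
    by (simp only: Bochner_Integration.integral_diff) (simp add: algebra_simps)
qed

lemma duhamel_diff:
  assumes G: "dominated K G" and H: "dominated L H"
  shows "duhamel T G G t \<xi> - duhamel T H H t \<xi>
    = duhamel T (\<lambda>t \<xi>. G t \<xi> - H t \<xi>) G t \<xi> + duhamel T H (\<lambda>t \<xi>. G t \<xi> - H t \<xi>) t \<xi>"
proof -
  note D = dominated_diff[OF G H]
  show ?thesis
    unfolding duhamel_def
    by (subst set_integral_diff(2)[symmetric, OF set_integrable_duhamel[OF G G] set_integrable_duhamel[OF H H]],
        subst set_integral_add(2)[symmetric, OF set_integrable_duhamel[OF D G] set_integrable_duhamel[OF H D]])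
      (simp add: ft_prod_dominated_diff[OF G H] flip: distrib_left right_diff_distrib)
qed

lemma dominated_duhamel_diff:
  assumes G: "dominated K G" and H: "dominated L H" and D: "dominated M (\<lambda>t \<xi>. G t \<xi> - H t \<xi>)"
    and T: "0 \<le> T"
  shows "dominated (2 * T * M * (K + L)) (\<lambda>t \<xi>. duhamel T G G t \<xi> - duhamel T H H t \<xi>)"
  using dominated_add[OF dominated_duhamel[OF D G T] dominated_duhamel[OF H D T]]
  by (simp add: duhamel_diff[OF G H] algebra_simps)

lemma duhamel_scale:
  "duhamel T (\<lambda>t \<xi>. of_real c * G t \<xi>) (\<lambda>t \<xi>. of_real c * G t \<xi>) t \<xi>
     = of_real (c\<^sup>2) * duhamel T G G t \<xi>"
proof -
  have "ft_prod (\<lambda>\<xi>. of_real c * G r \<xi>) (\<lambda>\<xi>. of_real c * G r \<xi>) \<xi> = of_real (c\<^sup>2) * ft_prod (G r) (G r) \<xi>" for r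
  proof -
    have *: "of_real c * x * (of_real c * y) = of_real (c\<^sup>2) * (x * y)" for x y :: complex
      by (simp add: power2_eq_square)
    show ?thesis
      unfolding ft_prod_def * integral_mult_right_zero by (simp only: mult.left_commute)
  qed
  then show ?thesis
    unfolding duhamel_def by (simp only: set_integral_mult_right mult.left_commute)
qed

section \<open>Solutions of the integral equation for small data\<close>

lemma dominated_mono: "dominated K G \<Longrightarrow> K \<le> K' \<Longrightarrow> dominated K' G"
  unfolding dominated_def using weight_pos
  by (meson less_imp_le mult_right_mono order_trans)

text \<open>
  This identifies the dominated symbols with the bounded continuous functions of time and
  frequency, a complete space.
\<close>

definition weighted :: "((real \<times> real) \<Rightarrow>\<^sub>C complex) \<Rightarrow> real \<Rightarrow> real \<Rightarrow> complex" where
  "weighted F t \<xi> = apply_bcontfun F (t, \<xi>) * of_real (weight \<xi>)"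

lemma dominated_weighted: "dominated (norm F) (weighted F)"
proof -
  have "continuous_on UNIV (\<lambda>p. apply_bcontfun F p * of_real (weight (snd p)))"
    by (intro continuous_intros continuous_on_apply_bcontfun)
  then show ?thesis
    using norm_bounded[of F] weight_pos
    by (auto simp: dominated_def weighted_def norm_mult less_imp_le intro!: mult_right_mono)
qed

lemma weighted_diff: "weighted F t \<xi> - weighted F' t \<xi> = weighted (F - F') t \<xi>"
  by (simp add: weighted_def minus_bcontfun.rep_eq left_diff_distrib)

lemma ex_weighted:
  assumes "dominated K G"
  shows "\<exists>F. norm F \<le> K \<and> weighted F = G"
proof -
  let ?g = "\<lambda>p. G (fst p) (snd p) / of_real (weight (snd p))"
  have bd: "norm (?g p) \<le> K" for p
    using dominated_norm_le[OF assms, of "fst p" "snd p"] weight_pos[of "snd p"]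
    by (simp add: norm_divide divide_le_eq)
  have "continuous_on UNIV ?g"
    using assms weight_pos by (auto simp: dominated_def less_imp_neq[symmetric] intro!: continuous_intros)
  then have "?g \<in> bcontfun"
    using bd by (rule bcontfun_normI)
  then have F: "apply_bcontfun (Bcontfun ?g) = ?g"
    by (rule Bcontfun_inverse)
  then have "norm (Bcontfun ?g) \<le> K"
    using bd by (intro norm_bound) simp
  moreover have "weighted (Bcontfun ?g) = G"
    using weight_pos by (simp add: fun_eq_iff weighted_def F less_imp_neq[symmetric])
  ultimately show ?thesis
    by blast
qed

text \<open>
  Contraction on the ball of radius \<open>2 K\<close>: the quadratic term has size \<open>2 T (2 K)\<^sup>2 \<le> K\<close> and
  Lipschitz constant \<open>2 T (2 K + 2 K) \<le> 1/2\<close> there.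
\<close>

lemma ex_integral_equation:
  assumes L: "dominated K L" and T: "0 \<le> T" and small: "16 * T * K \<le> 1"
  obtains G where "dominated (2 * K) G" "\<And>t \<xi>. G t \<xi> = L t \<xi> - duhamel T G G t \<xi>"
proof -
  have K: "0 \<le> K"
    by (rule dominated_nonneg[OF L])
  let ?S = "cball 0 (2 * K) :: ((real \<times> real) \<Rightarrow>\<^sub>C complex) set"
  define A where "A F = (\<lambda>t \<xi>. L t \<xi> - duhamel T (weighted F) (weighted F) t \<xi>)" for F
  \<comment> \<open>A choice is harmless: the weight is positive, so that \<open>weighted\<close> is injective.\<close>
  define \<Phi> where "\<Phi> F = (SOME F'. norm F' \<le> 2 * K \<and> weighted F' = A F)" for F
  have F: "dominated (2 * K) (weighted F)" if "F \<in> ?S" for F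
    using that by (intro dominated_mono[OF dominated_weighted]) simp
  have "norm (\<Phi> F) \<le> 2 * K \<and> weighted (\<Phi> F) = A F" if "F \<in> ?S" for F
    unfolding \<Phi>_def
  proof (rule someI_ex, rule ex_weighted)
    have "16 * T * K * K \<le> 1 * K" "0 \<le> T * K * K"
      using mult_right_mono[OF small K] K T by auto
    then show "dominated (2 * K) (A F)"
      unfolding A_def
      by (intro dominated_mono[OF dominated_diff[OF L dominated_duhamel[OF F F T]]] that)
        (simp add: algebra_simps)
  qed
  then have \<Phi>: "norm (\<Phi> F) \<le> 2 * K" "weighted (\<Phi> F) = A F" if "F \<in> ?S" for F
    using that by auto
  have "\<exists>!F\<in>?S. \<Phi> F = F"
  proof (rule Banach_fix[where c = "1/2"])
    show "complete ?S"
      by (simp add: complete_eq_closed)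
    show "?S \<noteq> {}"
      using K by auto
    show "\<Phi> ` ?S \<subseteq> ?S"
      using \<Phi>(1) by auto
    fix F F' assume FF': "F \<in> ?S" "F' \<in> ?S"
    show "dist (\<Phi> F) (\<Phi> F') \<le> 1 / 2 * dist F F'"
    proof (rule dist_bound)
      fix p :: "real \<times> real"
      obtain t \<xi> where p: "p = (t, \<xi>)"
        by (cases p)
      have "dominated (norm (F - F')) (\<lambda>t \<xi>. weighted F t \<xi> - weighted F' t \<xi>)"
        unfolding weighted_diff by (rule dominated_weighted)
      from dominated_duhamel_diff[OF F[OF FF'(1)] F[OF FF'(2)] this T]
      have "cmod (duhamel T (weighted F) (weighted F) t \<xi> - duhamel T (weighted F') (weighted F') t \<xi>)
          \<le> 2 * T * norm (F - F') * (2 * K + 2 * K) * weight \<xi>"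
        by (rule dominated_norm_le)
      also have "\<dots> = (16 * T * K) * (1 / 2 * norm (F - F') * weight \<xi>)"
        by simp
      also have "\<dots> \<le> 1 * (1 / 2 * norm (F - F') * weight \<xi>)"
        using small weight_pos[of \<xi>] by (intro mult_right_mono) auto
      finally have "cmod (weighted (\<Phi> F - \<Phi> F') t \<xi>) \<le> 1 / 2 * norm (F - F') * weight \<xi>"
        unfolding weighted_diff[symmetric] \<Phi>(2)[OF FF'(1)] \<Phi>(2)[OF FF'(2)] A_def
        by (simp add: norm_minus_commute)
      then have "cmod (apply_bcontfun (\<Phi> F - \<Phi> F') p) * weight \<xi> \<le> 1 / 2 * norm (F - F') * weight \<xi>"
        using weight_pos[of \<xi>] by (simp add: weighted_def norm_mult p)
      then have "cmod (apply_bcontfun (\<Phi> F - \<Phi> F') p) \<le> 1 / 2 * norm (F - F')"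
        using weight_pos[of \<xi>] by (metis mult_le_cancel_right_pos)
      then show "dist (apply_bcontfun (\<Phi> F) p) (apply_bcontfun (\<Phi> F') p) \<le> 1 / 2 * dist F F'"
        by (simp add: dist_norm minus_bcontfun.rep_eq)
    qed
  qed auto
  then obtain F where "F \<in> ?S" "\<Phi> F = F"
    by auto
  with \<Phi>(2)[of F] F[of F] show thesis
    by (intro that[of "weighted F"]) (auto simp: A_def fun_eq_iff)
qed

lemma integrable_bracket_dominated:
  assumes [measurable]: "f \<in> borel_measurable borel" and "\<And>\<xi>. cmod (f \<xi>) \<le> K * weight \<xi>"
  shows "integrable lborel (\<lambda>\<xi>. (bracket \<xi> powr \<sigma> * cmod (f \<xi>))\<^sup>2)"
    and "(bracket \<xi> powr \<sigma> * cmod (f \<xi>))\<^sup>2 \<le> K\<^sup>2 * (bracket \<xi> powr \<sigma> * weight \<xi>)\<^sup>2"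
proof -
  show *: "(bracket \<xi> powr \<sigma> * cmod (f \<xi>))\<^sup>2 \<le> K\<^sup>2 * (bracket \<xi> powr \<sigma> * weight \<xi>)\<^sup>2" for \<xi>
  proof -
    have "bracket \<xi> powr \<sigma> * cmod (f \<xi>) \<le> bracket \<xi> powr \<sigma> * (K * weight \<xi>)"
      by (intro mult_left_mono assms) auto
    then have "(bracket \<xi> powr \<sigma> * cmod (f \<xi>))\<^sup>2 \<le> (bracket \<xi> powr \<sigma> * (K * weight \<xi>))\<^sup>2"
      by (intro power_mono) auto
    then show ?thesis
      by (simp add: power_mult_distrib algebra_simps)
  qed
  show "integrable lborel (\<lambda>\<xi>. (bracket \<xi> powr \<sigma> * cmod (f \<xi>))\<^sup>2)"
    by (rule Bochner_Integration.integrable_bound[OF integrable_mult_right[OF integrable_bracket_weight, of "K\<^sup>2" \<sigma>]])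
      (use * in \<open>auto intro!: AE_I2 order_trans[OF _ abs_ge_self]\<close>)
qed

text \<open>
  The weight beats every power, so a dominated symbol is a curve in \<open>H\<^sup>\<sigma>\<close> for every \<open>\<sigma>\<close>;
  continuity in time is dominated convergence. Outside the time interval the curve has to be frozen
  at its end point values.
\<close>

lemma ex_curve_of_dominated:
  assumes G: "dominated K G" and T: "0 \<le> T"
  obtains u where "u \<in> curves T"
    "\<And>t. t \<in> {0..T} \<Longrightarrow> AE \<xi> in lborel. sobolev_ft \<sigma> (apply_bcontfun u t) \<xi> = G t \<xi>"
proof -
  let ?c = "\<lambda>t. max 0 (min t T)"
  define v where "v t = sobolev_of_ft \<sigma> (G (?c t))" for t
  note mG = dominated_measurable[OF G]
  have v: "AE \<xi> in lborel. sobolev_ft \<sigma> (v t) \<xi> = G (?c t) \<xi>" for t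
    unfolding v_def
    by (intro sobolev_ft_of_ft integrable_bracket_dominated(1)[OF _ dominated_norm_le[OF G]] mG)
  have "(norm (v t))\<^sup>2 \<le> (LINT \<xi>|lborel. K\<^sup>2 * (bracket \<xi> powr \<sigma> * weight \<xi>)\<^sup>2)" for t
    unfolding norm_sobolev_eq[OF v mG]
    by (intro integral_mono integrable_bracket_dominated[OF mG dominated_norm_le[OF G]]
        integrable_mult_right integrable_bracket_weight)
  then have bd: "norm (v t) \<le> sqrt (LINT \<xi>|lborel. K\<^sup>2 * (bracket \<xi> powr \<sigma> * weight \<xi>)\<^sup>2)" for t
    by (rule real_le_rsqrt)
  have cont: "isCont v a" for a
  proof -
    define J where "J t = (LINT \<xi>|lborel. (bracket \<xi> powr \<sigma> * cmod (G t \<xi> - G (?c a) \<xi>))\<^sup>2)" for t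
    have D: "cmod (G t \<xi> - G (?c a) \<xi>) \<le> (K + K) * weight \<xi>" for t \<xi>
      using norm_triangle_ineq4[of "G t \<xi>" "G (?c a) \<xi>"] dominated_norm_le[OF G, of t \<xi>]
        dominated_norm_le[OF G, of "?c a" \<xi>] by (simp add: algebra_simps)
    have mD: "(\<lambda>\<xi>. G t \<xi> - G (?c a) \<xi>) \<in> borel_measurable borel" for t
      using mG by (intro borel_measurable_diff) auto
    have "continuous_on UNIV J"
      unfolding J_def
    proof (rule continuous_on_integral_dominated)
      show "integrable lborel (\<lambda>\<xi>. (K + K)\<^sup>2 * (bracket \<xi> powr \<sigma> * weight \<xi>)\<^sup>2)"
        by (intro integrable_mult_right integrable_bracket_weight)
      show "continuous_on UNIV (\<lambda>t. (bracket \<xi> powr \<sigma> * cmod (G t \<xi> - G (?c a) \<xi>))\<^sup>2)" for \<xi>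
        by (intro continuous_intros dominated_continuous_on[OF G])
      show "(\<lambda>\<xi>. (bracket \<xi> powr \<sigma> * cmod (G t \<xi> - G (?c a) \<xi>))\<^sup>2) \<in> borel_measurable lborel" for t
        using mD[of t, measurable] by measurable
      show "norm ((bracket \<xi> powr \<sigma> * cmod (G t \<xi> - G (?c a) \<xi>))\<^sup>2)
          \<le> (K + K)\<^sup>2 * (bracket \<xi> powr \<sigma> * weight \<xi>)\<^sup>2" for t \<xi>
        using integrable_bracket_dominated(2)[OF mD D] by simp
    qed
    then have "continuous_on UNIV (\<lambda>t. J (?c t))"
      by (rule continuous_on_compose2) (intro continuous_intros, simp)
    then have "continuous_on UNIV (\<lambda>t. sqrt (J (?c t)))"
      by (rule continuous_on_real_sqrt)
    then have "(\<lambda>t. sqrt (J (?c t))) \<midarrow>a\<rightarrow> sqrt (J (?c a))"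
      by (simp add: continuous_on_eq_continuous_at isCont_def)
    moreover have "sqrt (J (?c t)) = norm (v t - v a)" for t
    proof -
      have "AE \<xi> in lborel. sobolev_ft \<sigma> (v t - v a) \<xi> = G (?c t) \<xi> - G (?c a) \<xi>"
        using sobolev_ft_diff[of \<sigma> "v t" "v a"] v[of t] v[of a] by eventually_elim simp
      then have "(norm (v t - v a))\<^sup>2 = J (?c t)"
        unfolding J_def by (rule norm_sobolev_eq[OF _ mD])
      then show ?thesis
        by (metis norm_ge_zero real_sqrt_abs abs_of_nonneg)
    qed
    moreover have "J (?c a) = 0"
      by (simp add: J_def)
    ultimately show ?thesis
      by (simp add: isCont_def LIM_zero_iff tendsto_norm_zero_iff)
  qed
  have "v \<in> bcontfun"
    using bd by (intro bcontfun_normI) (auto simp: continuous_on_eq_continuous_at cont)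
  then have V: "apply_bcontfun (Bcontfun v) = v"
    by (rule Bcontfun_inverse)
  show thesis
  proof (rule that)
    show "Bcontfun v \<in> curves T"
      using T by (simp add: curves_def V v_def)
    show "AE \<xi> in lborel. sobolev_ft \<sigma> (apply_bcontfun (Bcontfun v) t) \<xi> = G t \<xi>" if "t \<in> {0..T}" for t
      using v[of t] that by (simp add: V)
  qed
qed

lemma dominated_measurable_compose:
  assumes "dominated K G" and [measurable]: "f \<in> borel_measurable M" "g \<in> borel_measurable M"
  shows "(\<lambda>x. G (f x) (g x)) \<in> borel_measurable M"
proof -
  have "(\<lambda>p. G (fst p) (snd p)) \<in> borel_measurable (borel \<Otimes>\<^sub>M borel)"
    using assms(1) by (simp add: dominated_def borel_measurable_continuous_onI borel_prod)
  moreover have "(\<lambda>x. (f x, g x)) \<in> M \<rightarrow>\<^sub>M borel \<Otimes>\<^sub>M borel"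
    by measurable
  ultimately show ?thesis
    using measurable_compose[of "\<lambda>x. (f x, g x)" M _ "\<lambda>p. G (fst p) (snd p)"] by simp
qed

lemma cutoff_le: "cmod (cutoff N f \<xi>) \<le> cmod (f \<xi>)"
  by (simp add: cutoff_def)

lemma cutoff_measurable [measurable]:
  assumes [measurable]: "f \<in> borel_measurable borel"
  shows "cutoff N f \<in> borel_measurable borel"
  unfolding cutoff_def by measurable

lemma square_ft_cong_AE:
  assumes [measurable]: "f \<in> borel_measurable borel" "g \<in> borel_measurable borel"
    and eq: "AE x in lborel. f x = g x"
  shows "square_ft f \<xi> = square_ft g \<xi>"
proof -
  have "AE x in lborel. f (\<xi> - x) = g (\<xi> - x)"
    using AE_borel_affine[of "-1" "\<lambda>x. f x = g x" \<xi>] eq by simp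
  then have "AE x in lborel. f (\<xi> - x) * f x = g (\<xi> - x) * g x"
    using eq by eventually_elim simp
  then have "(LINT x|lborel. f (\<xi> - x) * f x) = (LINT x|lborel. g (\<xi> - x) * g x)"
    by (intro integral_cong_AE) auto
  then show ?thesis
    by (simp add: square_ft_def)
qed

lemma tendsto_square_ft_cutoff:
  assumes f: "f \<in> borel_measurable borel" and bd: "\<And>\<xi>. cmod (f \<xi>) \<le> K * weight \<xi>"
  shows "((\<lambda>N. square_ft (cutoff N f) \<xi>) \<longlongrightarrow> square_ft f \<xi>) at_top"
  unfolding square_ft_def
proof (intro tendsto_intros integral_dominated_convergence_at_top)
  note [measurable] = f
  show "integrable lborel (\<lambda>\<eta>. K * K * (weight (\<xi> - \<eta>) * weight \<eta>))"
    by (intro integrable_mult_right integrable_weight_mult)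
  show "\<forall>\<^sub>F N in at_top. AE \<eta> in lborel. cmod (cutoff N f (\<xi> - \<eta>) * cutoff N f \<eta>)
      \<le> K * K * (weight (\<xi> - \<eta>) * weight \<eta>)"
    by (intro always_eventually allI AE_I2 integrable_prod_weight(2) cutoff_measurable f
        order_trans[OF cutoff_le bd])
  show "AE \<eta> in lborel. ((\<lambda>N. cutoff N f (\<xi> - \<eta>) * cutoff N f \<eta>) \<longlongrightarrow> f (\<xi> - \<eta>) * f \<eta>) at_top"
  proof (rule AE_I2, rule tendsto_eventually)
    fix \<eta>
    show "\<forall>\<^sub>F N in at_top. cutoff N f (\<xi> - \<eta>) * cutoff N f \<eta> = f (\<xi> - \<eta>) * f \<eta>"
      using eventually_ge_at_top[of "max \<bar>\<xi> - \<eta>\<bar> \<bar>\<eta>\<bar>"]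
      by eventually_elim (simp add: cutoff_def)
  qed
  show "(\<lambda>\<eta>. f (\<xi> - \<eta>) * f \<eta>) \<in> borel_measurable lborel"
    "(\<lambda>\<eta>. cutoff N f (\<xi> - \<eta>) * cutoff N f \<eta>) \<in> borel_measurable lborel" for N
    by measurable
qed

lemma duhamel_eq_initial_interval:
  assumes "t \<in> {0..T}"
  shows "duhamel T G G t \<xi> = (LINT r:{0..t}|lborel. duhamel_kernel (t - r) \<xi> * square_ft (G r) \<xi>)"
  unfolding duhamel_def set_lebesgue_integral_def square_ft_eq
  by (rule Bochner_Integration.integral_cong) (use assms in \<open>auto simp: indicator_def max_def\<close>)

text \<open>
  For a dominated symbol the frequency truncation in the notion of solution is harmless: dominated
  convergence removes it from the convolution, then from the time integral, and finally from the
  pairing with a test function.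
\<close>

lemma is_solutionI_dominated:
  assumes G: "dominated K G" and T: "0 \<le> T"
    and u: "\<And>t. t \<in> {0..T} \<Longrightarrow> AE \<xi> in lborel. sobolev_ft s (apply_bcontfun u t) \<xi> = G t \<xi>"
    and eq: "\<And>t. t \<in> {0..T} \<Longrightarrow> AE \<xi> in lborel. G t \<xi> = linear_part s z t \<xi> - duhamel T G G t \<xi>"
  shows "is_solution s T z u"
  unfolding is_solution_def
proof (intro ballI allI impI)
  fix t \<theta> assume t: "t \<in> {0..T}" and \<theta>: "schwartz \<theta>"
  note mG [measurable] = dominated_measurable_compose[OF G]
  let ?D = "\<lambda>N \<xi>. LINT r:{0..t}|lborel. duhamel_kernel (t - r) \<xi> * square_ft (cutoff N (G r)) \<xi>"
  obtain D B where D: "D (0::nat) = \<theta>" "\<And>j x. (D j has_vector_derivative D (Suc j) x) (at x)"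
    and "\<And>j k. bounded (range (\<lambda>x. x ^ k *\<^sub>R D j x))"
    using \<theta> by (auto simp: schwartz_def)
  from this(3)[of 0 0] obtain B where B: "\<And>x. cmod (\<theta> x) \<le> B"
    by (auto simp: bounded_iff D(1))
  have "continuous_on UNIV \<theta>"
    using D(2)[of 0] unfolding D(1) continuous_on_eq_continuous_at[OF open_UNIV]
    by (blast intro: has_vector_derivative_continuous)
  then have m\<theta> [measurable]: "\<theta> \<in> borel_measurable borel"
    by (rule borel_measurable_continuous_onI)
  have B0: "0 \<le> B"
    using B[of 0] norm_ge_zero order_trans by blast
  have mV [measurable]: "(\<lambda>\<xi>. Vc t \<xi>) \<in> borel_measurable borel" "(\<lambda>\<xi>. Vs t \<xi>) \<in> borel_measurable borel"
    unfolding Vc_eq Vs_eq gam_def by measurable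
  have mk [measurable]: "(\<lambda>p. duhamel_kernel (f p) (g p)) \<in> borel_measurable M"
    if [measurable]: "f \<in> borel_measurable M" "g \<in> borel_measurable M" for f g :: "'x \<Rightarrow> real" and M
    unfolding duhamel_kernel_eq gam_def by measurable
  have mS [measurable]: "(\<lambda>p. square_ft (cutoff N (G (f p))) (g p)) \<in> borel_measurable M"
    if [measurable]: "f \<in> borel_measurable M" "g \<in> borel_measurable M" for f g :: "'x \<Rightarrow> real" and M N
    unfolding square_ft_def cutoff_def by measurable
  have "(\<lambda>\<xi>. G t \<xi>) \<in> borel_measurable borel" for t
    by measurable
  then have mGt: "G t \<in> borel_measurable borel" for t
    by simp
  have bdS: "cmod (square_ft (cutoff N (G r)) \<xi>) \<le> 2 * (K * K) * weight \<xi>" for N r \<xi>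
    unfolding square_ft_eq
    by (intro norm_ft_prod_le cutoff_measurable mGt order_trans[OF cutoff_le dominated_norm_le[OF G]])
  have bdk: "cmod (duhamel_kernel (t - r) \<xi> * square_ft (cutoff N (G r)) \<xi>) \<le> 2 * (K * K) * weight \<xi>"
    for N r \<xi>
    unfolding norm_mult using mult_mono[OF norm_duhamel_kernel_le_1 bdS] by fastforce
  have ind: "integrable lborel (\<lambda>r. indicator {0..t} r *\<^sub>R (2 * (K * K) * weight \<xi>))" for \<xi>
    by (rule borel_integrable_compact) auto
  have part: "duhamel_part s N (apply_bcontfun u) t \<xi> = ?D N \<xi>" for N \<xi>
    unfolding duhamel_part_def
  proof (rule set_lebesgue_integral_cong, simp, intro allI impI)
    fix r assume "r \<in> {0..t}"
    then have "AE \<xi> in lborel. cutoff N (sobolev_ft s (apply_bcontfun u r)) \<xi> = cutoff N (G r) \<xi>"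
      using u[of r] t by (auto simp: cutoff_def elim: eventually_mono)
    then have "square_ft (cutoff N (sobolev_ft s (apply_bcontfun u r))) \<xi> = square_ft (cutoff N (G r)) \<xi>"
      by (intro square_ft_cong_AE cutoff_measurable mGt sobolev_ft_measurable)
    then show "Vs (t - r) \<xi> * ((\<i> * of_real \<xi>)\<^sup>2 * square_ft (cutoff N (sobolev_ft s (apply_bcontfun u r))) \<xi>)
        = duhamel_kernel (t - r) \<xi> * square_ft (cutoff N (G r)) \<xi>"
      by (simp add: duhamel_kernel_def)
  qed
  have lim: "((\<lambda>N. ?D N \<xi>) \<longlongrightarrow> duhamel T G G t \<xi>) at_top" for \<xi>
    unfolding duhamel_eq_initial_interval[OF t] set_lebesgue_integral_def
  proof (rule integral_dominated_convergence_at_top[OF _ _ ind])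
    show "(\<lambda>r. indicator {0..t} r *\<^sub>R (duhamel_kernel (t - r) \<xi> * square_ft (G r) \<xi>)) \<in> borel_measurable lborel"
      unfolding square_ft_def by measurable
    show "(\<lambda>r. indicator {0..t} r *\<^sub>R (duhamel_kernel (t - r) \<xi> * square_ft (cutoff N (G r)) \<xi>))
        \<in> borel_measurable lborel" for N
      by measurable
    show "AE r in lborel. ((\<lambda>N. indicator {0..t} r *\<^sub>R (duhamel_kernel (t - r) \<xi> * square_ft (cutoff N (G r)) \<xi>))
        \<longlongrightarrow> indicator {0..t} r *\<^sub>R (duhamel_kernel (t - r) \<xi> * square_ft (G r) \<xi>)) at_top"
      by (intro AE_I2 tendsto_intros tendsto_square_ft_cutoff[OF mGt dominated_norm_le[OF G]])
    show "\<forall>\<^sub>F N in at_top. AE r in lborel.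
        cmod (indicator {0..t} r *\<^sub>R (duhamel_kernel (t - r) \<xi> * square_ft (cutoff N (G r)) \<xi>))
          \<le> indicator {0..t} r *\<^sub>R (2 * (K * K) * weight \<xi>)"
      using bdk by (intro always_eventually allI AE_I2) (simp add: indicator_def)
  qed
  have bdD: "cmod (?D N \<xi>) \<le> 2 * T * (K * K) * weight \<xi>" for N \<xi>
  proof -
    have "cmod (?D N \<xi>) \<le> (LINT r|lborel. indicator {0..t} r *\<^sub>R (2 * (K * K) * weight \<xi>))"
      unfolding set_lebesgue_integral_def
    proof (rule order_trans[OF integral_norm_bound integral_mono[OF _ ind]])
      show le: "cmod (indicator {0..t} r *\<^sub>R (duhamel_kernel (t - r) \<xi> * square_ft (cutoff N (G r)) \<xi>))
          \<le> indicator {0..t} r *\<^sub>R (2 * (K * K) * weight \<xi>)" for r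
        using bdk by (simp add: indicator_def)
      show "integrable lborel
          (\<lambda>r. cmod (indicator {0..t} r *\<^sub>R (duhamel_kernel (t - r) \<xi> * square_ft (cutoff N (G r)) \<xi>)))"
      proof (rule Bochner_Integration.integrable_bound[OF ind[of \<xi>]])
        show "AE r in lborel.
            norm (cmod (indicator {0..t} r *\<^sub>R (duhamel_kernel (t - r) \<xi> * square_ft (cutoff N (G r)) \<xi>)))
              \<le> norm (indicator {0..t} r *\<^sub>R (2 * (K * K) * weight \<xi>))"
          using order_trans[OF le abs_ge_self] by (intro AE_I2) (simp only: real_norm_def abs_norm_cancel)
      qed measurable
    qed
    also have "\<dots> = t * (2 * (K * K) * weight \<xi>)"
      using t by simp
    also have "\<dots> \<le> T * (2 * (K * K) * weight \<xi>)"
      using t weight_pos[of \<xi>] by (intro mult_right_mono) auto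
    finally show ?thesis by (simp add: ac_simps)
  qed
  have mD [measurable]: "(\<lambda>\<xi>. ?D N \<xi>) \<in> borel_measurable borel" for N
    unfolding set_lebesgue_integral_def by measurable
  have mdu [measurable]: "(\<lambda>\<xi>. duhamel T G G t \<xi>) \<in> borel_measurable borel"
    using dominated_measurable[OF dominated_duhamel[OF G G T]] by simp
  have ml [measurable]: "(\<lambda>\<xi>. linear_part s z t \<xi>) \<in> borel_measurable borel"
    unfolding linear_part_def by measurable
  have "((\<lambda>N. LINT \<xi>|lborel. \<theta> \<xi> * (linear_part s z t \<xi> - ?D N \<xi>))
      \<longlongrightarrow> (LINT \<xi>|lborel. \<theta> \<xi> * (linear_part s z t \<xi> - duhamel T G G t \<xi>))) at_top"
  proof (rule integral_dominated_convergence_at_top)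
    let ?C = "K + 2 * T * K * K + 2 * T * (K * K)"
    show "integrable lborel (\<lambda>\<xi>. B * (?C * weight \<xi>))"
      by (intro integrable_mult_right integrable_weight)
    show "AE \<xi> in lborel. ((\<lambda>N. \<theta> \<xi> * (linear_part s z t \<xi> - ?D N \<xi>))
        \<longlongrightarrow> \<theta> \<xi> * (linear_part s z t \<xi> - duhamel T G G t \<xi>)) at_top"
      by (intro AE_I2 tendsto_intros lim)
    show "\<forall>\<^sub>F N in at_top. AE \<xi> in lborel. cmod (\<theta> \<xi> * (linear_part s z t \<xi> - ?D N \<xi>)) \<le> B * (?C * weight \<xi>)"
    proof (rule always_eventually, rule allI)
      fix N
      show "AE \<xi> in lborel. cmod (\<theta> \<xi> * (linear_part s z t \<xi> - ?D N \<xi>)) \<le> B * (?C * weight \<xi>)"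
        using eq[OF t]
      proof eventually_elim
        case (elim \<xi>)
        then have eq': "linear_part s z t \<xi> - ?D N \<xi> = G t \<xi> + duhamel T G G t \<xi> - ?D N \<xi>"
          by simp
        have "cmod (linear_part s z t \<xi> - ?D N \<xi>)
            \<le> cmod (G t \<xi>) + cmod (duhamel T G G t \<xi>) + cmod (?D N \<xi>)"
          unfolding eq' by (rule order_trans[OF norm_triangle_ineq4 add_right_mono[OF norm_triangle_ineq]])
        also have "\<dots> \<le> ?C * weight \<xi>"
          using dominated_norm_le[OF G, of t \<xi>] dominated_norm_le[OF dominated_duhamel[OF G G T], of t \<xi>]
            bdD[of \<xi> N] by (simp add: algebra_simps)
        finally show ?case
          unfolding norm_mult by (intro mult_mono B B0) auto
      qed
    qed
  qed measurable
  moreover have "(LINT \<xi>|lborel. \<theta> \<xi> * (linear_part s z t \<xi> - duhamel T G G t \<xi>))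
      = (LINT \<xi>|lborel. \<theta> \<xi> * sobolev_ft s (apply_bcontfun u t) \<xi>)"
  proof (rule integral_cong_AE)
    show "AE \<xi> in lborel. \<theta> \<xi> * (linear_part s z t \<xi> - duhamel T G G t \<xi>)
        = \<theta> \<xi> * sobolev_ft s (apply_bcontfun u t) \<xi>"
      using u[OF t] eq[OF t] by eventually_elim simp
  qed measurable
  ultimately show "((\<lambda>N. LINT \<xi>|lborel. \<theta> \<xi> * (linear_part s z t \<xi> - duhamel_part s N (apply_bcontfun u) t \<xi>))
      \<longlongrightarrow> (LINT \<xi>|lborel. \<theta> \<xi> * sobolev_ft s (apply_bcontfun u t) \<xi>)) at_top"
    unfolding part by simp
qed

section \<open>Second differences of the flow map\<close>

text \<open>
  Differentiability of the derivative at zero makes it Lipschitz at zero, and the mean value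
  inequality turns this into a first order Taylor formula with a quadratic remainder, applied at y
  and at 2y. Second differences have the advantage that the linear terms cancel, so that the
  first derivative need not be known.
\<close>

lemma C2_at_second_difference:
  fixes f :: "'a::real_normed_vector \<Rightarrow> 'b::real_normed_vector"
  assumes "C2_at f 0"
  obtains M d where "d > 0"
    "\<And>y. norm y < d \<Longrightarrow> norm (f (2 *\<^sub>R y) - 2 *\<^sub>R f y + f 0) \<le> M * (norm y)\<^sup>2"
proof -
  obtain U and f' :: "'a \<Rightarrow> 'a \<Rightarrow>\<^sub>L 'b" and f'' :: "'a \<Rightarrow> 'a \<Rightarrow>\<^sub>L ('a \<Rightarrow>\<^sub>L 'b)"
    where U: "open U" "0 \<in> U" and f': "\<And>y. y \<in> U \<Longrightarrow> (f has_derivative f' y) (at y)"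
      and f'': "(f' has_derivative f'' 0) (at 0)"
    using assms unfolding C2_at_def by blast
  obtain r where r: "r > 0" "ball 0 r \<subseteq> U"
    using U open_contains_ball by blast
  obtain e where e: "e > 0" "\<And>y. norm y < e \<Longrightarrow> norm (f' y - f' 0 - f'' 0 y) \<le> norm y"
    using f'' unfolding has_derivative_at_alt by (metis diff_zero mult_1 zero_less_one)
  define M where "M = norm (f'' 0) + 1"
  have lip: "norm (f' y - f' 0) \<le> M * norm y" if "norm y < e" for y
  proof -
    have "norm (f' y - f' 0) \<le> norm (f' y - f' 0 - f'' 0 y) + norm (f'' 0 y)"
      using norm_triangle_ineq[of "f' y - f' 0 - f'' 0 y" "f'' 0 y"] by simp
    also have "\<dots> \<le> norm y + norm (f'' 0) * norm y"
      by (intro add_mono e(2) that norm_blinfun)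
    also have "norm y + norm (f'' 0) * norm y = M * norm y"
      unfolding M_def by (simp only: distrib_right mult_1 add.commute)
    finally show ?thesis .
  qed
  have taylor: "norm (f y - f 0 - f' 0 y) \<le> M * (norm y)\<^sup>2" if "norm y < min r e" for y
  proof -
    have "norm (f y - f 0 - blinfun_apply (f' 0) (y - 0)) \<le> norm (y - 0) * (M * norm y)"
    proof (rule differentiable_bound_linearization[where S = "cball 0 (norm y)" and f' = "\<lambda>x. blinfun_apply (f' x)"])
      fix x :: 'a assume x: "x \<in> cball 0 (norm y)"
      then have x': "norm x \<le> norm y" "norm x < r" "norm x < e"
        using that by auto
      show "(f has_derivative f' x) (at x within cball 0 (norm y))"
        using r(2) x'(2) by (intro has_derivative_at_withinI[OF f']) (simp add: subset_iff)
      have "onorm (blinfun_apply (f' x) - blinfun_apply (f' 0)) = norm (f' x - f' 0)"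
        by (simp add: norm_blinfun.rep_eq minus_blinfun.rep_eq fun_diff_def)
      also have "\<dots> \<le> M * norm y"
        using lip[OF x'(3)] x'(1) by (smt (verit) M_def norm_ge_zero mult_left_mono)
      finally show "onorm (blinfun_apply (f' x) - blinfun_apply (f' 0)) \<le> M * norm y" .
    next
      show "0 + t *\<^sub>R (y - 0) \<in> cball 0 (norm y)" if "t \<in> {0..1}" for t
        using that by (simp add: mult_left_le_one_le)
    qed auto
    then show ?thesis
      by (simp add: power2_eq_square ac_simps)
  qed
  show thesis
  proof (rule that)
    show "min r e / 2 > 0"
      using r e by simp
    fix y :: 'a assume y: "norm y < min r e / 2"
    then have y1: "norm y < min r e"
      using norm_ge_zero[of y] by linarith
    have y2: "norm (2 *\<^sub>R y) < min r e"
      using y by simp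
    have "f (2 *\<^sub>R y) - 2 *\<^sub>R f y + f 0
        = (f (2 *\<^sub>R y) - f 0 - f' 0 (2 *\<^sub>R y)) - 2 *\<^sub>R (f y - f 0 - f' 0 y)"
      by (simp add: blinfun.scaleR_right algebra_simps flip: scaleR_2)
    also have "norm \<dots> \<le> norm (f (2 *\<^sub>R y) - f 0 - f' 0 (2 *\<^sub>R y)) + norm (2 *\<^sub>R (f y - f 0 - f' 0 y))"
      by (rule norm_triangle_ineq4)
    also have "\<dots> \<le> M * (norm (2 *\<^sub>R y))\<^sup>2 + 2 * (M * (norm y)\<^sup>2)"
      unfolding norm_scaleR[of 2 "f y - f 0 - f' 0 y"]
      using taylor[OF y1] taylor[OF y2] by simp
    also have "\<dots> = (6 * M) * (norm y)\<^sup>2"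
      by (simp add: power_mult_distrib)
    finally show "norm (f (2 *\<^sub>R y) - 2 *\<^sub>R f y + f 0) \<le> (6 * M) * (norm y)\<^sup>2" .
  qed
qed

text \<open>
  The constructed solution is smooth, hence lies in the uniqueness class, hence is the value of
  the flow map.
\<close>

lemma flow_map_of_small_data:
  assumes wp: "locally_well_posed s T X" and T: "0 \<le> T"
    and L: "dominated K L" "16 * T * K \<le> 1"
    and lin: "\<And>t. AE \<xi> in lborel. linear_part s z t \<xi> = L t \<xi>"
  obtains G where "dominated (2 * K) G" "\<And>t \<xi>. G t \<xi> = L t \<xi> - duhamel T G G t \<xi>"
    "\<And>t. t \<in> {0..T} \<Longrightarrow>
      AE \<xi> in lborel. sobolev_ft s (apply_bcontfun (flow_map s T X z) t) \<xi> = G t \<xi>"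
proof -
  obtain G where G: "dominated (2 * K) G" "\<And>t \<xi>. G t \<xi> = L t \<xi> - duhamel T G G t \<xi>"
    using ex_integral_equation[OF L(1) T L(2)] by blast
  obtain u where u: "u \<in> curves T"
    "\<And>t. t \<in> {0..T} \<Longrightarrow> AE \<xi> in lborel. sobolev_ft s (apply_bcontfun u t) \<xi> = G t \<xi>"
    using ex_curve_of_dominated[OF G(1) T, of s] by blast
  have "smooth_curve s T u"
    unfolding smooth_curve_def
  proof
    fix \<sigma>
    obtain v where v: "v \<in> curves T"
      "\<And>t. t \<in> {0..T} \<Longrightarrow> AE \<xi> in lborel. sobolev_ft \<sigma> (apply_bcontfun v t) \<xi> = G t \<xi>"
      using ex_curve_of_dominated[OF G(1) T, of \<sigma>] by blast
    have "AE \<xi> in lborel. sobolev_ft \<sigma> (apply_bcontfun v t) \<xi> = sobolev_ft s (apply_bcontfun u t) \<xi>"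
      if "t \<in> {0..T}" for t
      using v(2)[OF that] u(2)[OF that] by eventually_elim simp
    with v(1) show "\<exists>v\<in>curves T. \<forall>t\<in>{0..T}. AE \<xi> in lborel.
        sobolev_ft \<sigma> (apply_bcontfun v t) \<xi> = sobolev_ft s (apply_bcontfun u t) \<xi>"
      by blast
  qed
  moreover have sol: "is_solution s T z u"
  proof (rule is_solutionI_dominated[OF G(1) T u(2)])
    show "AE \<xi> in lborel. G t \<xi> = linear_part s z t \<xi> - duhamel T G G t \<xi>" for t
      using lin[of t] by eventually_elim (simp add: G(2)[of t])
  qed
  ultimately have "u \<in> X"
    using wp u(1) unfolding locally_well_posed_def by blast
  moreover have "\<exists>!u. u \<in> X \<and> is_solution s T z u"
    using wp unfolding locally_well_posed_def by blast
  ultimately have "flow_map s T X z = u"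
    unfolding flow_map_def using sol by (intro the1_equality) auto
  with G u(2) show thesis
    by (intro that) auto
qed

text \<open>
  The solution differs from L by the quadratic term, which is \<open>O(K\<^sup>2)\<close>; replacing the solution
  by L inside the quadratic term therefore causes an error \<open>O(K\<^sup>3)\<close>.
\<close>

lemma integral_equation_second_order:
  assumes L: "dominated K L" and G: "dominated (2 * K) G" and T: "0 \<le> T"
    and eq: "\<And>t \<xi>. G t \<xi> = L t \<xi> - duhamel T G G t \<xi>"
  shows "cmod (G t \<xi> - L t \<xi> + duhamel T L L t \<xi>) \<le> 48 * T\<^sup>2 * K ^ 3 * weight \<xi>"
proof -
  have "G t \<xi> - L t \<xi> = of_real (- 1) * duhamel T G G t \<xi>" for t \<xi>
    using eq[of t \<xi>] by simp
  then have "dominated (8 * T * K\<^sup>2) (\<lambda>t \<xi>. G t \<xi> - L t \<xi>)"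
    using dominated_scale[OF dominated_duhamel[OF G G T], of "- 1"]
    by (simp add: power2_eq_square ac_simps)
  from dominated_norm_le[OF dominated_duhamel_diff[OF G L this T], of t \<xi>]
  have "cmod (duhamel T G G t \<xi> - duhamel T L L t \<xi>) \<le> 48 * T\<^sup>2 * K ^ 3 * weight \<xi>"
    by (simp add: power2_eq_square power3_eq_cube ac_simps)
  moreover have "G t \<xi> - L t \<xi> + duhamel T L L t \<xi> = - (duhamel T G G t \<xi> - duhamel T L L t \<xi>)"
    using eq[of t \<xi>] by simp
  ultimately show ?thesis
    by (metis norm_minus_cancel)
qed

section \<open>Data concentrated at high frequency\<close>

definition tent :: "real \<Rightarrow> real \<Rightarrow> real" where
  "tent N \<xi> = max 0 (1 - \<bar>\<bar>\<xi>\<bar> - N\<bar>)"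

lemma tent_bounds: "0 \<le> tent N \<xi>" "tent N \<xi> \<le> 1"
  by (auto simp: tent_def)

lemma tent_support: "tent N \<xi> \<noteq> 0 \<Longrightarrow> N - 1 \<le> \<bar>\<xi>\<bar> \<and> \<bar>\<xi>\<bar> \<le> N + 1"
  by (auto simp: tent_def max_def split: if_splits)

lemma tent_le_weight:
  assumes "N \<ge> 0"
  shows "tent N \<xi> \<le> inverse (weight (N + 1)) * weight \<xi>"
proof (cases "tent N \<xi> = 0")
  case True
  then show ?thesis
    using weight_pos by (simp add: less_imp_le)
next
  case False
  then have \<xi>: "\<bar>\<xi>\<bar> \<le> N + 1"
    by (simp add: tent_support)
  have "exp (- (N + 1)) \<le> exp (- \<bar>\<xi>\<bar>)"
    using \<xi> by simp
  moreover have "\<xi>\<^sup>2 \<le> (N + 1)\<^sup>2"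
    using \<xi> by (metis abs_ge_zero power2_abs power_mono)
  ultimately have "weight (N + 1) \<le> weight \<xi>"
    unfolding weight_def using assms by (intro frac_le) auto
  then have "1 \<le> inverse (weight (N + 1)) * weight \<xi>"
    using weight_pos[of "N + 1"] by (simp add: field_simps)
  then show ?thesis
    using tent_bounds(2)[of N \<xi>] by simp
qed

text \<open>
  The Fourier transform of the free wave with data \<open>(\<phi>, 0)\<close>, where \<open>\<phi>\<close> has the Fourier transform
  \<open>tent N\<close>.
\<close>

definition tent_wave :: "real \<Rightarrow> real \<Rightarrow> real \<Rightarrow> complex" where
  "tent_wave N t \<xi> = of_real (cos (t * gam \<xi>) * tent N \<xi>)"

lemma dominated_tent_wave:
  assumes "N \<ge> 0"
  shows "dominated (inverse (weight (N + 1))) (tent_wave N)"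
proof -
  have "cmod (tent_wave N t \<xi>) \<le> inverse (weight (N + 1)) * weight \<xi>" for t \<xi>
  proof -
    have "cmod (tent_wave N t \<xi>) = \<bar>cos (t * gam \<xi>)\<bar> * tent N \<xi>"
      unfolding tent_wave_def norm_of_real abs_mult using tent_bounds by simp
    also have "\<dots> \<le> tent N \<xi>"
      using tent_bounds by (simp add: mult_left_le_one_le)
    also have "\<dots> \<le> inverse (weight (N + 1)) * weight \<xi>"
      by (rule tent_le_weight[OF assms])
    finally show ?thesis .
  qed
  then show ?thesis
    unfolding dominated_def tent_wave_def tent_def by (auto intro!: continuous_intros)
qed

lemma norm_tent_datum:
  assumes "AE \<xi> in lborel. sobolev_ft s Z \<xi> = of_real (tent N \<xi>)" and s: "s \<le> 0" and N: "N \<ge> 1"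
  shows "(norm Z)\<^sup>2 \<le> 4 * (N powr s)\<^sup>2"
proof -
  have [measurable]: "tent N \<in> borel_measurable borel"
    unfolding tent_def by measurable
  have ind: "integrable lborel (indicator {a..b} :: real \<Rightarrow> real)" for a b :: real
    using borel_integrable_compact[of "{a..b}" "\<lambda>_. 1::real"] by simp
  let ?g = "\<lambda>\<xi>. (N powr s)\<^sup>2 * (indicator {N - 1..N + 1} \<xi> + indicator {- N - 1..- N + 1} \<xi>)"
  have g: "integrable lborel ?g"
    by (intro integrable_mult_right Bochner_Integration.integrable_add ind)
  have le: "(bracket \<xi> powr s * cmod (of_real (tent N \<xi>)))\<^sup>2 \<le> ?g \<xi>" for \<xi>
  proof (cases "tent N \<xi> = 0")
    case False
    then have \<xi>: "N - 1 \<le> \<bar>\<xi>\<bar> \<and> \<bar>\<xi>\<bar> \<le> N + 1"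
      by (rule tent_support)
    then have "bracket \<xi> powr s \<le> N powr s"
      using s N by (intro powr_mono2') (auto simp: bracket_def)
    then have "bracket \<xi> powr s * cmod (of_real (tent N \<xi>)) \<le> N powr s * 1"
      using tent_bounds[of N \<xi>] by (intro mult_mono) auto
    then have "(bracket \<xi> powr s * cmod (of_real (tent N \<xi>)))\<^sup>2 \<le> (N powr s * 1)\<^sup>2"
      by (intro power_mono) auto
    also have "\<dots> \<le> ?g \<xi>"
      using \<xi> by (auto simp: indicator_def abs_if split: if_splits)
    finally show ?thesis .
  qed (simp add: indicator_def)
  have "(norm Z)\<^sup>2 = (LINT \<xi>|lborel. (bracket \<xi> powr s * cmod (of_real (tent N \<xi>)))\<^sup>2)"
    by (rule norm_sobolev_eq[OF assms(1)]) measurable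
  also have "\<dots> \<le> (LINT \<xi>|lborel. ?g \<xi>)"
  proof (rule integral_mono[OF _ g le])
    show "integrable lborel (\<lambda>\<xi>. (bracket \<xi> powr s * cmod (of_real (tent N \<xi>)))\<^sup>2)"
    proof (rule Bochner_Integration.integrable_bound[OF g])
      show "AE \<xi> in lborel. norm ((bracket \<xi> powr s * cmod (of_real (tent N \<xi>)))\<^sup>2) \<le> norm (?g \<xi>)"
        using order_trans[OF le abs_ge_self] by (intro AE_I2) (simp only: real_norm_def abs_power2)
    qed measurable
  qed
  also have "\<dots> = 4 * (N powr s)\<^sup>2"
    by (simp add: ind)
  finally show ?thesis .
qed

lemma gam_le: "gam \<xi> \<le> (1 + \<bar>\<xi>\<bar>)\<^sup>2"
proof -
  have "sqrt (1 + \<xi>\<^sup>2) \<le> 1 + \<bar>\<xi>\<bar>"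
    by (rule real_le_lsqrt) (auto simp: power2_sum)
  then have "\<bar>\<xi>\<bar> * sqrt (1 + \<xi>\<^sup>2) \<le> (1 + \<bar>\<xi>\<bar>) * (1 + \<bar>\<xi>\<bar>)"
    by (intro mult_mono) auto
  then show ?thesis
    by (simp add: gam_eq power2_eq_square)
qed

lemma gam_nonneg: "0 \<le> gam \<xi>"
  by (simp add: gam_eq)

text \<open>
  This is what fixes the time scale \<open>1 / N\<^sup>2\<close>: before it, waves of frequency up to \<open>N + 1\<close> have not
  turned by more than one radian.
\<close>

lemma phase_le_1:
  assumes "0 \<le> r" "r \<le> 1 / (N + 2)\<^sup>2" "\<bar>\<xi>\<bar> \<le> N + 1" "N \<ge> 0"
  shows "r * gam \<xi> \<le> 1"
proof -
  have "r * gam \<xi> \<le> 1 / (N + 2)\<^sup>2 * (1 + \<bar>\<xi>\<bar>)\<^sup>2"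
    using assms gam_le gam_nonneg by (intro mult_mono) auto
  also have "\<dots> \<le> 1 / (N + 2)\<^sup>2 * (N + 2)\<^sup>2"
    using assms by (intro mult_left_mono power_mono) auto
  also have "\<dots> = 1"
    using assms by simp
  finally show ?thesis .
qed

lemma cos_ge_half: "0 \<le> x \<Longrightarrow> x \<le> 1 \<Longrightarrow> 1 / 2 \<le> cos (x::real)"
  using cos_monotone_0_pi_le[of x "pi / 3"] pi_gt3 by (simp add: cos_60)

lemma sin_ge_half:
  assumes "0 \<le> x" "x \<le> (1::real)"
  shows "x / 2 \<le> sin x"
proof -
  have "sin 0 - 0 / 2 \<le> sin x - x / 2"
  proof (rule DERIV_nonneg_imp_nondecreasing[OF assms(1)])
    fix y assume "0 \<le> y" "y \<le> x"
    then show "\<exists>d. ((\<lambda>y. sin y - y / 2) has_real_derivative d) (at y) \<and> 0 \<le> d"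
      using cos_ge_half[of y] assms
      by (intro exI[of _ "cos y - 1 / 2"]) (auto intro!: derivative_eq_intros)
  qed
  then show ?thesis by simp
qed

text \<open>
  For \<open>\<eta>\<close> within 1/4 of N the frequencies \<open>\<eta>\<close> and \<open>\<xi> - \<eta>\<close> lie under the tents at N and at -N. There
  the tents are at least 3/4 and 1/4, each cosine is at least 1/2, and the interval has length
  1/2; the rest of the integrand is nonnegative. This gives 3/128 for the integral, and
  \<open>2 \<pi> \<le> 8\<close> gives the constant.
\<close>

lemma ft_prod_tent_wave_ge:
  assumes N: "N \<ge> 1" and r: "0 \<le> r" "r \<le> 1 / (N + 2)\<^sup>2" and \<xi>: "\<xi> \<in> {1/4..1/2}"
  obtains q where "ft_prod (tent_wave N r) (tent_wave N r) \<xi> = of_real q" "1 / 512 \<le> q"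
proof -
  let ?l = "\<lambda>\<xi>. cos (r * gam \<xi>) * tent N \<xi>"
  have l: "1 / 2 * tent N \<xi> \<le> ?l \<xi>" for \<xi>
  proof (cases "tent N \<xi> = 0")
    case False
    then have "r * gam \<xi> \<le> 1"
      using N r tent_support[of N \<xi>] by (intro phase_le_1[of r N]) auto
    then show ?thesis
      by (intro mult_right_mono[OF cos_ge_half tent_bounds(1)] mult_nonneg_nonneg r(1) gam_nonneg)
  qed simp
  have "complex_integrable lborel (\<lambda>\<eta>. tent_wave N r (\<xi> - \<eta>) * tent_wave N r \<eta>)"
    by (rule integrable_prod_weight(1)[OF dominated_measurable dominated_measurable
          dominated_norm_le dominated_norm_le])
      (rule dominated_tent_wave, use N in simp)+
  then have "complex_integrable lborel (\<lambda>\<eta>. of_real (?l (\<xi> - \<eta>) * ?l \<eta>))"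
    by (simp add: tent_wave_def)
  then have int: "integrable lborel (\<lambda>\<eta>. ?l (\<xi> - \<eta>) * ?l \<eta>)"
    by (simp only: complex_of_real_integrable_eq)
  have le: "indicator {N - 1/4..N + 1/4} \<eta> * (3/64) \<le> ?l (\<xi> - \<eta>) * ?l \<eta>" for \<eta>
  proof -
    have *: "(1 / 2 * tent N (\<xi> - \<eta>)) * (1 / 2 * tent N \<eta>) \<le> ?l (\<xi> - \<eta>) * ?l \<eta>"
      using tent_bounds by (intro mult_mono l order_trans[OF _ l]) auto
    show ?thesis
    proof (cases "\<eta> \<in> {N - 1/4..N + 1/4}")
      case True
      then have "3/4 \<le> tent N \<eta>" "1/4 \<le> tent N (\<xi> - \<eta>)"
        using \<xi> N unfolding tent_def by (auto simp: abs_if max_def)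
      then have "(1/2 * (1/4)) * (1/2 * (3/4)) \<le> (1 / 2 * tent N (\<xi> - \<eta>)) * (1 / 2 * tent N \<eta>)"
        by (intro mult_mono) auto
      with * True show ?thesis
        by simp
    next
      case False
      have "0 \<le> (1 / 2 * tent N (\<xi> - \<eta>)) * (1 / 2 * tent N \<eta>)"
        using tent_bounds by simp
      with * False show ?thesis
        by simp
    qed
  qed
  have "(LINT \<eta>|lborel. indicator {N - 1/4..N + 1/4} \<eta> * (3/64)) \<le> (LINT \<eta>|lborel. ?l (\<xi> - \<eta>) * ?l \<eta>)"
    using borel_integrable_compact[of "{N - 1/4..N + 1/4}" "\<lambda>_. 3/64::real"] int le
    by (intro integral_mono) auto
  then have ge: "3 / 128 \<le> (LINT \<eta>|lborel. ?l (\<xi> - \<eta>) * ?l \<eta>)"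
    by simp
  show thesis
  proof (rule that)
    show "ft_prod (tent_wave N r) (tent_wave N r) \<xi>
        = of_real (1 / (2 * pi) * (LINT \<eta>|lborel. ?l (\<xi> - \<eta>) * ?l \<eta>))"
      unfolding ft_prod_def tent_wave_def by (simp only: integral_complex_of_real of_real_mult[symmetric])
    have "1 / 8 \<le> 1 / (2 * pi)"
      using pi_less_4 by (simp add: field_simps)
    then have "1 / 8 * (3 / 128) \<le> 1 / (2 * pi) * (LINT \<eta>|lborel. ?l (\<xi> - \<eta>) * ?l \<eta>)"
      using ge by (intro mult_mono) auto
    then show "1 / 512 \<le> 1 / (2 * pi) * (LINT \<eta>|lborel. ?l (\<xi> - \<eta>) * ?l \<eta>)"
      by (rule order_trans[rotated]) simp
  qed
qed

text \<open>
  Since \<open>sin x \<ge> x / 2\<close> on the unit interval, the kernel with time lag \<open>t - r\<close> is at least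
  \<open>\<xi>\<^sup>2 (t - r) / 2 \<ge> (t - r) / 32\<close> in size and has a fixed sign. For simplicity only the times
  \<open>r \<le> t / 2\<close> are kept, where the lag is at least \<open>t / 2\<close>: this gives
  \<open>t/2 \<cdot> t/2 \<cdot> 1/32 \<cdot> 1/512\<close>.
\<close>

lemma duhamel_tent_wave_ge:
  assumes N: "N \<ge> 1" and t: "t = 1 / (N + 2)\<^sup>2" "t \<le> T" and \<xi>: "\<xi> \<in> {1/4..1/2}"
  shows "t\<^sup>2 / 65536 \<le> cmod (duhamel T (tent_wave N) (tent_wave N) t \<xi>)"
proof -
  let ?I = "\<lambda>r. indicator {0..T} r *\<^sub>R
    (duhamel_kernel (max 0 (t - r)) \<xi> * ft_prod (tent_wave N r) (tent_wave N r) \<xi>)"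
  have t0: "0 < t"
    using N t by simp
  have I: "integrable lborel ?I"
    using set_integrable_duhamel[OF dominated_tent_wave dominated_tent_wave, of N N] N
    by (simp add: set_integrable_def)
  have le: "indicator {0..t/2} r * (t / 32768) \<le> Re (- ?I r)" for r
  proof (cases "r \<in> {0..t}")
    case True
    then obtain q where q: "ft_prod (tent_wave N r) (tent_wave N r) \<xi> = of_real q" "1 / 512 \<le> q"
      using ft_prod_tent_wave_ge[OF N _ _ \<xi>, of r] t by auto
    let ?k = "\<bar>\<xi>\<bar> / sqrt (1 + \<xi>\<^sup>2) * sin ((t - r) * gam \<xi>)"
    have "(t - r) * gam \<xi> \<le> 1"
      using True t N \<xi> by (intro phase_le_1[of _ N]) auto
    then have "\<bar>\<xi>\<bar> / sqrt (1 + \<xi>\<^sup>2) * ((t - r) * gam \<xi> / 2) \<le> ?k"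
      using True gam_nonneg by (intro mult_left_mono sin_ge_half) auto
    also have "\<bar>\<xi>\<bar> / sqrt (1 + \<xi>\<^sup>2) * ((t - r) * gam \<xi> / 2) = \<xi>\<^sup>2 * ((t - r) / 2)"
    proof -
      have "e \<noteq> 0 \<Longrightarrow> a / e * (b * (a * e) / 2) = a\<^sup>2 * (b / 2)" for a b e :: real
        by (simp add: power2_eq_square)
      from this[of "sqrt (1 + \<xi>\<^sup>2)" "\<bar>\<xi>\<bar>" "t - r"] show ?thesis
        by (simp add: gam_eq)
    qed
    finally have k: "\<xi>\<^sup>2 * ((t - r) / 2) \<le> ?k" .
    have "(1/4)\<^sup>2 \<le> \<xi>\<^sup>2"
      using \<xi> by (intro power_mono) auto
    then have "(1/4)\<^sup>2 * ((t - r) / 2) \<le> \<xi>\<^sup>2 * ((t - r) / 2)"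
      using True by (intro mult_right_mono) auto
    with k have k': "(t - r) / 32 \<le> ?k"
      by (simp add: power2_eq_square)
    have "indicator {0..t/2} r * (t / 32768) \<le> (t - r) / 32 * (1 / 512)"
      using True by (auto simp: indicator_def)
    also have "\<dots> \<le> ?k * q"
      using k' q True by (intro mult_mono order_trans[OF _ k']) auto
    also have "\<dots> = Re (- ?I r)"
      using True t unfolding q duhamel_kernel_eq by simp
    finally show ?thesis .
  next
    case False
    then show ?thesis
      using t0 by (auto simp: indicator_def max_def)
  qed
  have "(LINT r|lborel. indicator {0..t/2} r * (t / 32768)) \<le> (LINT r|lborel. Re (- ?I r))"
  proof (rule integral_mono[OF _ _ le])
    show "integrable lborel (\<lambda>r. indicator {0..t/2} r * (t / 32768))"
      using borel_integrable_compact[of "{0..t/2}" "\<lambda>_. t / 32768"] by simp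
    show "integrable lborel (\<lambda>r. Re (- ?I r))"
      by (intro integrable_Re Bochner_Integration.integrable_minus I)
  qed
  also have "\<dots> = Re (- duhamel T (tent_wave N) (tent_wave N) t \<xi>)"
    unfolding duhamel_def set_lebesgue_integral_def Bochner_Integration.integral_minus[symmetric]
    by (rule integral_Re[OF Bochner_Integration.integrable_minus[OF I]])
  also have "\<dots> \<le> cmod (duhamel T (tent_wave N) (tent_wave N) t \<xi>)"
    using complex_Re_le_cmod[of "- duhamel T (tent_wave N) (tent_wave N) t \<xi>"] by simp
  finally show ?thesis
    using t0 by (simp add: power2_eq_square)
qed

lemma ex_tent_datum:
  assumes "N \<ge> 0"
  obtains Z where "AE \<xi> in lborel. sobolev_ft s Z \<xi> = of_real (tent N \<xi>)"
proof -
  have "(\<lambda>\<xi>. of_real (tent N \<xi>) :: complex) \<in> borel_measurable borel"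
    unfolding tent_def by measurable
  moreover have "cmod (of_real (tent N \<xi>)) \<le> inverse (weight (N + 1)) * weight \<xi>" for \<xi>
    using tent_le_weight[OF assms] tent_bounds by simp
  ultimately show ?thesis
    using that sobolev_ft_of_ft[OF _ integrable_bracket_dominated(1)] by blast
qed

lemma linear_part_tent_datum:
  assumes "AE \<xi> in lborel. sobolev_ft s Z \<xi> = of_real (tent N \<xi>)"
  shows "AE \<xi> in lborel. linear_part s (e *\<^sub>R (Z, 0)) t \<xi> = of_real e * tent_wave N t \<xi>"
  using assms sobolev_ft_scaleR[of s e Z] sobolev_ft_zero[of "s - 1"]
  by eventually_elim (simp add: linear_part_def Vc_eq tent_wave_def scaleR_conv_of_real)

text \<open>
  At these frequencies the bracket is at most 2, so that the negative power \<open>s\<close> of it is at least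
  \<open>2\<^sup>s\<close>; the window has length 1/4, whence the factor 1/2 for its square root.
\<close>

lemma norm_ge_on_window:
  assumes f: "AE \<xi> in lborel. sobolev_ft s w \<xi> = f \<xi>" and [measurable]: "f \<in> borel_measurable borel"
    and s: "s \<le> 0" and c: "c \<ge> 0" and ge: "\<And>\<xi>. \<xi> \<in> {1/4..1/2} \<Longrightarrow> c \<le> cmod (f \<xi>)"
  shows "2 powr s * c / 2 \<le> norm w"
proof -
  have "indicator {1/4..1/2} \<xi> * (2 powr s * c)\<^sup>2 \<le> (bracket \<xi> powr s * cmod (f \<xi>))\<^sup>2" for \<xi>
  proof (cases "\<xi> \<in> {1/4..1/2}")
    case True
    then have "2 powr s \<le> bracket \<xi> powr s"
      using s by (intro powr_mono2') (auto simp: bracket_def)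
    then have "2 powr s * c \<le> bracket \<xi> powr s * cmod (f \<xi>)"
      using ge[OF True] c by (intro mult_mono) auto
    then show ?thesis
      using True c by (simp add: power_mono)
  qed simp
  moreover have int: "integrable lborel (\<lambda>\<xi>. (bracket \<xi> powr s * cmod (f \<xi>))\<^sup>2)"
    by (rule integrable_cong_AE_imp[OF sobolev_ft_integrable[of s w]])
      (use f in \<open>auto elim: eventually_mono\<close>)
  moreover have "integrable lborel (\<lambda>\<xi>::real. indicator {1/4..1/2} \<xi> * (2 powr s * c)\<^sup>2)"
    using borel_integrable_compact[of "{1/4..1/2::real}" "\<lambda>_. (2 powr s * c)\<^sup>2"] by simp
  ultimately have "(LINT \<xi>|lborel. indicator {1/4..1/2::real} \<xi> * (2 powr s * c)\<^sup>2)
      \<le> (LINT \<xi>|lborel. (bracket \<xi> powr s * cmod (f \<xi>))\<^sup>2)"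
    by (intro integral_mono) auto
  then have "(2 powr s * c)\<^sup>2 / 4 \<le> (norm w)\<^sup>2"
    unfolding norm_sobolev_eq[OF f, simplified] by simp
  then have "(2 powr s * c / 2)\<^sup>2 \<le> (norm w)\<^sup>2"
    by (simp add: power_divide)
  then show ?thesis
    by (rule power2_le_imp_le) simp
qed

text \<open>
  The second difference at \<open>e z\<close> is \<open>- 2 e\<^sup>2 D\<close> up to an error \<open>O(e\<^sup>3)\<close> whose constant depends badly
  on N. As N is fixed here while e tends to zero, half of the main term absorbs the error.
\<close>

lemma second_difference_flow_map_ge:
  assumes wp: "locally_well_posed s T X" and s: "s \<le> 0"
    and N: "N \<ge> 1" and t: "t = 1 / (N + 2)\<^sup>2" "t \<le> T"
    and Z: "AE \<xi> in lborel. sobolev_ft s Z \<xi> = of_real (tent N \<xi>)"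
  shows "\<forall>\<^sub>F e in at_right 0. 2 powr s * t\<^sup>2 / 131072 * e\<^sup>2
    \<le> norm (flow_map s T X ((2 * e) *\<^sub>R (Z, 0)) - 2 *\<^sub>R flow_map s T X (e *\<^sub>R (Z, 0)) + flow_map s T X 0)"
proof -
  define K where "K = inverse (weight (N + 1))"
  have t0: "t > 0"
    using N t by simp
  then have T: "0 < T"
    using t(2) by linarith
  have L: "dominated K (tent_wave N)"
    unfolding K_def using N by (intro dominated_tent_wave) simp
  have K: "K > 0"
    unfolding K_def using weight_pos by simp
  let ?S = "\<lambda>e. flow_map s T X (e *\<^sub>R (Z, 0))"
  let ?W = "tent_wave N"
  have expansion: "\<exists>f. f \<in> borel_measurable borel \<and>
      (AE \<xi> in lborel. sobolev_ft s (apply_bcontfun (?S e) t) \<xi> = f \<xi>) \<and>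
      (\<forall>\<xi>. cmod (f \<xi> - of_real e * ?W t \<xi> + of_real (e\<^sup>2) * duhamel T ?W ?W t \<xi>)
        \<le> 48 * T\<^sup>2 * K ^ 3 * e ^ 3)"
    if e: "0 \<le> e" "16 * T * (e * K) \<le> 1" for e
  proof -
    let ?L = "\<lambda>t \<xi>. of_real e * ?W t \<xi>"
    have eL: "dominated (e * K) ?L"
      using dominated_scale[OF L, of e] e by simp
    obtain G where G: "dominated (2 * (e * K)) G" "\<And>t \<xi>. G t \<xi> = ?L t \<xi> - duhamel T G G t \<xi>"
      "\<And>t. t \<in> {0..T} \<Longrightarrow> AE \<xi> in lborel. sobolev_ft s (apply_bcontfun (?S e) t) \<xi> = G t \<xi>"
      using flow_map_of_small_data[OF wp less_imp_le[OF T] eL e(2) linear_part_tent_datum[OF Z]] by blast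
    have "cmod (G t \<xi> - of_real e * ?W t \<xi> + of_real (e\<^sup>2) * duhamel T ?W ?W t \<xi>)
        \<le> 48 * T\<^sup>2 * K ^ 3 * e ^ 3" for \<xi>
    proof -
      have "cmod (G t \<xi> - ?L t \<xi> + duhamel T ?L ?L t \<xi>) \<le> 48 * T\<^sup>2 * (e * K) ^ 3 * weight \<xi>"
        by (rule integral_equation_second_order[OF eL G(1) less_imp_le[OF T] G(2)])
      also have "\<dots> \<le> 48 * T\<^sup>2 * (e * K) ^ 3 * 1"
        using e K by (intro mult_left_mono weight_le_1) auto
      finally show ?thesis
        by (simp add: duhamel_scale power_mult_distrib ac_simps)
    qed
    moreover have "AE \<xi> in lborel. sobolev_ft s (apply_bcontfun (?S e) t) \<xi> = G t \<xi>"
      using t t0 by (intro G(3)) simp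
    ultimately show ?thesis
      using dominated_measurable[OF G(1), of t] by blast
  qed
  have "((\<lambda>e. 16 * T * (2 * e * K)) \<longlongrightarrow> 16 * T * (2 * 0 * K)) (at_right 0)"
    by (intro tendsto_intros)
  then have small1: "\<forall>\<^sub>F e in at_right 0. 16 * T * (2 * e * K) < 1"
    by (rule order_tendstoD) simp
  \<comment> \<open>The expansions at \<open>2 e\<close> and at \<open>e\<close> (twice) have errors adding up to \<open>(8 + 2) \<cdot> 48 = 480\<close>.\<close>
  have "((\<lambda>e. 480 * T\<^sup>2 * K ^ 3 * e) \<longlongrightarrow> 480 * T\<^sup>2 * K ^ 3 * 0) (at_right 0)"
    by (intro tendsto_intros)
  then have small2: "\<forall>\<^sub>F e in at_right 0. 480 * T\<^sup>2 * K ^ 3 * e < t\<^sup>2 / 65536"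
    by (rule order_tendstoD) (use t0 in simp)
  have pos: "\<forall>\<^sub>F e in at_right (0::real). 0 < e"
    by (rule eventually_at_right_less)
  show ?thesis
    using small1 small2 pos
  proof eventually_elim
    case (elim e)
    have "16 * T * (2 * e * K) = 2 * (16 * T * (e * K))" "0 \<le> 16 * T * (e * K)"
      using elim(3) T K by simp_all
    then have e1: "16 * T * (e * K) \<le> 1"
      using elim(1) by linarith
    have e2: "16 * T * (2 * e * K) \<le> 1" "0 \<le> e" "0 \<le> 2 * e"
      using elim by simp_all
    have f0: "AE \<xi> in lborel. sobolev_ft s (apply_bcontfun (?S 0) t) \<xi> = 0"
    proof -
      have "0 \<le> (0::real)" "16 * T * (0 * K) \<le> 1"
        by simp_all
      then obtain f where f: "AE \<xi> in lborel. sobolev_ft s (apply_bcontfun (?S 0) t) \<xi> = f \<xi>"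
        "\<And>\<xi>. cmod (f \<xi> - of_real 0 * ?W t \<xi> + of_real (0\<^sup>2) * duhamel T ?W ?W t \<xi>)
          \<le> 48 * T\<^sup>2 * K ^ 3 * 0 ^ 3"
        using expansion by blast
      from f(2) have "f \<xi> = 0" for \<xi>
        by simp
      with f(1) show ?thesis
        by simp
    qed
    obtain f1 where f1: "f1 \<in> borel_measurable borel"
      "AE \<xi> in lborel. sobolev_ft s (apply_bcontfun (?S e) t) \<xi> = f1 \<xi>"
      "\<And>\<xi>. cmod (f1 \<xi> - of_real e * ?W t \<xi> + of_real (e\<^sup>2) * duhamel T ?W ?W t \<xi>) \<le> 48 * T\<^sup>2 * K ^ 3 * e ^ 3"
      using expansion[OF e2(2) e1] by blast
    obtain f2 where f2: "f2 \<in> borel_measurable borel"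
      "AE \<xi> in lborel. sobolev_ft s (apply_bcontfun (?S (2 * e)) t) \<xi> = f2 \<xi>"
      "\<And>\<xi>. cmod (f2 \<xi> - of_real (2 * e) * ?W t \<xi> + of_real ((2 * e)\<^sup>2) * duhamel T ?W ?W t \<xi>)
        \<le> 48 * T\<^sup>2 * K ^ 3 * (2 * e) ^ 3"
      using expansion[OF e2(3,1)] by blast
    let ?w = "?S (2 * e) - 2 *\<^sub>R ?S e + ?S 0"
    have at_t: "apply_bcontfun ?w t
        = apply_bcontfun (?S (2 * e)) t - 2 *\<^sub>R apply_bcontfun (?S e) t + apply_bcontfun (?S 0) t"
      by (simp add: plus_bcontfun.rep_eq minus_bcontfun.rep_eq scaleR_bcontfun.rep_eq)
    have AE: "AE \<xi> in lborel. sobolev_ft s (apply_bcontfun ?w t) \<xi> = f2 \<xi> - 2 * f1 \<xi>"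
      unfolding at_t
      using sobolev_ft_add[of s "apply_bcontfun (?S (2 * e)) t - 2 *\<^sub>R apply_bcontfun (?S e) t" "apply_bcontfun (?S 0) t"]
        sobolev_ft_diff[of s "apply_bcontfun (?S (2 * e)) t" "2 *\<^sub>R apply_bcontfun (?S e) t"]
        sobolev_ft_scaleR[of s 2 "apply_bcontfun (?S e) t"] f0 f1(2) f2(2)
      by eventually_elim (simp add: scaleR_conv_of_real)
    have "2 powr s * (e\<^sup>2 * t\<^sup>2 / 65536) / 2 \<le> norm (apply_bcontfun ?w t)"
    proof (rule norm_ge_on_window[OF AE _ s])
      show "(\<lambda>\<xi>. f2 \<xi> - 2 * f1 \<xi>) \<in> borel_measurable borel"
        using f1(1) f2(1) by measurable
      fix \<xi> :: real assume \<xi>: "\<xi> \<in> {1/4..1/2}"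
      let ?D = "duhamel T ?W ?W t \<xi>"
      let ?r1 = "f1 \<xi> - of_real e * ?W t \<xi> + of_real (e\<^sup>2) * ?D"
      let ?r2 = "f2 \<xi> - of_real (2 * e) * ?W t \<xi> + of_real ((2 * e)\<^sup>2) * ?D"
      have "of_real (2 * e\<^sup>2) * ?D = ?r2 - 2 * ?r1 - (f2 \<xi> - 2 * f1 \<xi>)"
        by (simp add: algebra_simps power2_eq_square)
      then have "2 * e\<^sup>2 * cmod ?D = cmod (?r2 - 2 * ?r1 - (f2 \<xi> - 2 * f1 \<xi>))"
        by (metis abs_of_nonneg norm_mult norm_of_real zero_le_mult_iff zero_le_numeral zero_le_power2)
      also have "\<dots> \<le> cmod ?r2 + 2 * cmod ?r1 + cmod (f2 \<xi> - 2 * f1 \<xi>)"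
        using norm_triangle_ineq4[of "?r2 - 2 * ?r1" "f2 \<xi> - 2 * f1 \<xi>"] norm_triangle_ineq4[of ?r2 "2 * ?r1"]
        unfolding norm_mult norm_numeral by linarith
      also have "\<dots> \<le> 480 * T\<^sup>2 * K ^ 3 * e * e\<^sup>2 + cmod (f2 \<xi> - 2 * f1 \<xi>)"
        using f1(3)[of \<xi>] f2(3)[of \<xi>] by (simp add: power_mult_distrib power3_eq_cube power2_eq_square)
      also have "480 * T\<^sup>2 * K ^ 3 * e * e\<^sup>2 \<le> t\<^sup>2 / 65536 * e\<^sup>2"
        using elim by (intro mult_right_mono) auto
      finally have "2 * e\<^sup>2 * cmod ?D \<le> t\<^sup>2 / 65536 * e\<^sup>2 + cmod (f2 \<xi> - 2 * f1 \<xi>)"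
        by simp
      moreover have "2 * e\<^sup>2 * (t\<^sup>2 / 65536) \<le> 2 * e\<^sup>2 * cmod ?D"
        by (intro mult_left_mono duhamel_tent_wave_ge[OF N t \<xi>]) simp
      ultimately show "e\<^sup>2 * t\<^sup>2 / 65536 \<le> cmod (f2 \<xi> - 2 * f1 \<xi>)"
        by (simp add: algebra_simps)
    qed simp
    also have "norm (apply_bcontfun ?w t) \<le> norm ?w"
      by (rule norm_bounded)
    finally show ?case
      by (simp add: zero_prod_def algebra_simps)
  qed
qed

theorem theorem1p5:
  fixes s T :: real and X :: "(real \<Rightarrow>\<^sub>C L2) set"
  assumes "s < -2" and "T > 0" and "locally_well_posed s T X"
  shows "\<not> C2_at (flow_map s T X) 0"
proof
  let ?S = "flow_map s T X"
  assume "C2_at ?S 0"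
  then obtain M d where d: "d > 0"
    and M: "\<And>y. norm y < d \<Longrightarrow> norm (?S (2 *\<^sub>R y) - 2 *\<^sub>R ?S y + ?S 0) \<le> M * (norm y)\<^sup>2"
    by (rule C2_at_second_difference) blast
  \<comment> \<open>The right-hand side is of the order of \<open>N\<close> to the power \<open>2 s + 4\<close>.\<close>
  have bound: "2 powr s / 131072 \<le> M * 4 * ((N + 2) ^ 4 * (N powr s)\<^sup>2)"
    if N: "N \<ge> 1" and small: "1 / (N + 2)\<^sup>2 \<le> T" for N
  proof -
    define t where "t = 1 / (N + 2)\<^sup>2"
    obtain Z where Z: "AE \<xi> in lborel. sobolev_ft s Z \<xi> = of_real (tent N \<xi>)"
      using ex_tent_datum[of N s] N by auto
    have Z': "(norm Z)\<^sup>2 \<le> 4 * (N powr s)\<^sup>2"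
      using assms N by (intro norm_tent_datum[OF Z]) auto
    have "((\<lambda>e. norm (e *\<^sub>R (Z, 0::L2))) \<longlongrightarrow> norm (0 *\<^sub>R (Z, 0::L2))) (at_right 0)"
      by (intro tendsto_intros)
    then have near: "\<forall>\<^sub>F e in at_right 0. norm (e *\<^sub>R (Z, 0::L2)) < d"
      by (rule order_tendstoD) (use d in simp)
    have pos: "\<forall>\<^sub>F e in at_right (0::real). 0 < e"
      by (rule eventually_at_right_less)
    have ge: "\<forall>\<^sub>F e in at_right 0. 2 powr s * t\<^sup>2 / 131072 * e\<^sup>2
      \<le> norm (?S ((2 * e) *\<^sub>R (Z, 0)) - 2 *\<^sub>R ?S (e *\<^sub>R (Z, 0)) + ?S 0)"
      by (rule second_difference_flow_map_ge[OF assms(3) _ N t_def _ Z])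
        (use assms small in \<open>auto simp: t_def\<close>)
    have "\<forall>\<^sub>F e in at_right (0::real). 2 powr s * t\<^sup>2 / 131072 \<le> M * (norm Z)\<^sup>2"
      using near pos ge
    proof eventually_elim
      case (elim e)
      have "2 powr s * t\<^sup>2 / 131072 * e\<^sup>2 \<le> M * (norm (e *\<^sub>R (Z, 0::L2)))\<^sup>2"
        using elim(3) M[OF elim(1)] by simp
      also have "\<dots> = M * (norm Z)\<^sup>2 * e\<^sup>2"
        by (simp add: norm_Pair power_mult_distrib)
      finally show ?case
        using elim(2) by simp
    qed
    then have le: "2 powr s * t\<^sup>2 / 131072 \<le> M * (norm Z)\<^sup>2"
      by (simp add: eventually_const_iff)
    have "0 < 2 powr s * t\<^sup>2 / 131072"
      using N by (simp add: t_def)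
    then have "0 \<le> M"
      using le by (smt (verit) mult_nonneg_nonneg mult_nonpos_nonneg zero_le_power2)
    then have "2 powr s * t\<^sup>2 / 131072 \<le> M * (4 * (N powr s)\<^sup>2)"
      using le Z' by (meson mult_left_mono order_trans)
    then have main: "2 powr s * t\<^sup>2 / 131072 * (N + 2) ^ 4 \<le> M * (4 * (N powr s)\<^sup>2) * (N + 2) ^ 4"
      using N by (intro mult_right_mono) auto
    have scale: "2 powr s * t\<^sup>2 / 131072 * (N + 2) ^ 4 = 2 powr s / 131072"
    proof -
      have tN: "t\<^sup>2 * (N + 2) ^ 4 = 1"
        using N by (simp add: t_def power_divide flip: power_mult)
      have "2 powr s * t\<^sup>2 / 131072 * (N + 2) ^ 4 = 2 powr s / 131072 * (t\<^sup>2 * (N + 2) ^ 4)"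
        by simp
      then show ?thesis
        unfolding tN by simp
    qed
    show ?thesis
      using main unfolding scale by (simp only: ac_simps)
  qed
  have "((\<lambda>N::real. M * 4 * ((N + 2) ^ 4 * (N powr s)\<^sup>2)) \<longlongrightarrow> 0) at_top"
    using assms(1) by real_asymp
  then have "\<forall>\<^sub>F N::real in at_top. M * 4 * ((N + 2) ^ 4 * (N powr s)\<^sup>2) < 2 powr s / 131072"
    by (rule order_tendstoD) simp
  moreover have "((\<lambda>N::real. 1 / (N + 2)\<^sup>2) \<longlongrightarrow> 0) at_top"
    by real_asymp
  then have "\<forall>\<^sub>F N::real in at_top. 1 / (N + 2)\<^sup>2 < T"
    by (rule order_tendstoD) (use assms in simp)
  ultimately have "\<forall>\<^sub>F N::real in at_top. False"
    using eventually_ge_at_top[of "1::real"]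
    by eventually_elim (use bound in fastforce)
  then show False
    by simp
qed

end
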